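(* Let $\delta\in(0,1)$ and let $\tau\in(0,\frac12)$ satisfy $$g(\tau,\delta):=\frac{4\tau^4}{9(\frac12-\tau)^2\log(2/\delta)}\le\frac14.$$ Let $n$ be a positive integer with $n\ge\frac{9\log(2/\delta)}{2\tau^2}$, and set $$K=\left\lceil\frac{8}{(\frac12-\tau)^2}\log(2/\delta)\right\rceil,\qquad M=\left\lfloor\frac{2n\tau^2}{9\log(2/\delta)}\right\rfloor.$$ Let $X_1,\dots,X_n$ be i.i.d. in a measurable space $\mathcal{Z}$, and let $h:\mathcal{Z}\times\mathcal{Z}\to\mathbb{R}$ be a symmetric measurable kernel with $\mathbb{E}[h(X_1,X_2)^2]<\infty$ and $\theta(h)=\mathbb{E}[h(X_1,X_2)]$. Let $\check\theta_{\mathrm{MoIU}}(h)$ be the median-of-incomplete-U-statistics estimator whose $KM$ pairs are all drawn without replacement, across as well as within blocks (as defined in the context). Then, with probability at least $1-\delta$, $$\left|\check\theta_{\mathrm{MoIU}}(h)-\theta(h)\right|\le\sqrt{\frac{12\sigma_1^2(h)}{n\tau}+\frac{6\sigma_2^2(h)}{\tau n(n-1)}+\frac{27\sigma^2(h)\log(2/\delta)}{n\tau^3}}.$$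
   Context: Let $\Lambda_n=\{(i,j):1\le i<j\le n\}$. Independently of $(X_1,\dots,X_n)$, draw $KM$ pairs $(i_m^k,j_m^k)$, $1\le m\le M$, $1\le k\le K$, uniformly at random without replacement from $\Lambda_n$ (so all $KM$ pairs are distinct), and let block $\mathbf{J}_k$ consist of $(i_m^k,j_m^k)_{m=1}^M$. Define $\check U_{M,\mathbf{J}_k}(h)=\frac1M\sum_{m=1}^M h(X_{i_m^k},X_{j_m^k})$ and $\check\theta_{\mathrm{MoIU}}(h)=\mathrm{med}\big(\check U_{M,\mathbf{J}_1}(h),\dots,\check U_{M,\mathbf{J}_K}(h)\big)$, the usual sample median. Variances: $\sigma_1^2(h)=\mathrm{Var}(\mathbb{E}[h(X_1,X_2)\mid X_1])$, $\sigma^2(h)=\mathrm{Var}(h(X_1,X_2))$, $\sigma_2^2(h)=\sigma^2(h)-2\sigma_1^2(h)$. *)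

theory Defs
  imports "HOL-Probability.Probability"
begin

definition index_pairs :: "nat \<Rightarrow> (nat \<times> nat) set" where
  "index_pairs n = {(i, j). 1 \<le> i \<and> i < j \<and> j \<le> n}"

text \<open>
  The possible outcomes of drawing \<open>K * M\<close> pairs without replacement: injective families of pairs,
  the draw in position \<open>m\<close> of block \<open>k\<close> being indexed by \<open>(k, m)\<close>.
  The families are extensional, so that the set of outcomes is finite.
\<close>

definition draw_families :: "nat \<Rightarrow> nat \<Rightarrow> nat \<Rightarrow> (nat \<times> nat \<Rightarrow> nat \<times> nat) set" where
  "draw_families n K M =
     {f \<in> ({1..K} \<times> {1..M}) \<rightarrow>\<^sub>E index_pairs n. inj_on f ({1..K} \<times> {1..M})}"

definition joint_draw ::
  "nat \<Rightarrow> nat \<Rightarrow> (nat \<Rightarrow> nat \<Rightarrow> 'w \<Rightarrow> nat \<times> nat) \<Rightarrow> 'w \<Rightarrow> nat \<times> nat \<Rightarrow> nat \<times> nat" where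
  "joint_draw K M J \<omega> = (\<lambda>(k, m) \<in> {1..K} \<times> {1..M}. J k m \<omega>)"

definition uniform_draws ::
  "'w measure \<Rightarrow> nat \<Rightarrow> nat \<Rightarrow> nat \<Rightarrow> (nat \<Rightarrow> nat \<Rightarrow> 'w \<Rightarrow> nat \<times> nat) \<Rightarrow> bool" where
  "uniform_draws P n K M J \<longleftrightarrow>
     joint_draw K M J \<in> measurable P (count_space (draw_families n K M)) \<and>
     distr P (count_space (draw_families n K M)) (joint_draw K M J)
       = uniform_count_measure (draw_families n K M)"

definition iid_sample :: "'w measure \<Rightarrow> 'z measure \<Rightarrow> nat \<Rightarrow> (nat \<Rightarrow> 'w \<Rightarrow> 'z) \<Rightarrow> bool" where
  "iid_sample P Z n X \<longleftrightarrow>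
     prob_space.indep_vars P (\<lambda>_. Z) X {1..n} \<and>
     (\<forall>i\<in>{1..n}. distr P Z (X i) = distr P Z (X 1))"

text \<open>
  Independence of the draws and the sample is stated for the generated sigma-algebras, because
  \<^const>\<open>prob_space.indep_var\<close> requires both variables to have values in the same type.
\<close>

definition draws_indep_of_sample ::
  "'w measure \<Rightarrow> 'z measure \<Rightarrow> nat \<Rightarrow> nat \<Rightarrow> nat \<Rightarrow> (nat \<Rightarrow> 'w \<Rightarrow> 'z) \<Rightarrow>
     (nat \<Rightarrow> nat \<Rightarrow> 'w \<Rightarrow> nat \<times> nat) \<Rightarrow> bool" where
  "draws_indep_of_sample P Z n K M X J \<longleftrightarrow>
     prob_space.indep_set P
       (sets (vimage_algebra (space P) (\<lambda>\<omega>. \<lambda>i\<in>{1..n}. X i \<omega>) (PiM {1..n} (\<lambda>_. Z))))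
       (sets (vimage_algebra (space P) (joint_draw K M J) (count_space (draw_families n K M))))"

definition block_U ::
  "nat \<Rightarrow> (nat \<Rightarrow> 'w \<Rightarrow> 'z) \<Rightarrow> (nat \<Rightarrow> nat \<Rightarrow> 'w \<Rightarrow> nat \<times> nat) \<Rightarrow> ('z \<Rightarrow> 'z \<Rightarrow> real) \<Rightarrow>
     nat \<Rightarrow> 'w \<Rightarrow> real" where
  "block_U M X J h k \<omega> =
     (1 / real M) * (\<Sum>m = 1..M. h (X (fst (J k m \<omega>)) \<omega>) (X (snd (J k m \<omega>)) \<omega>))"

text \<open>For an even number of values, the sample median is the mean of the two middle ones.\<close>

definition sample_median :: "real list \<Rightarrow> real" where
  "sample_median xs =
     (let s = sort xs; l = length xs in
      if odd l then s ! (l div 2) else (s ! (l div 2 - 1) + s ! (l div 2)) / 2)"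

definition MoIU ::
  "nat \<Rightarrow> nat \<Rightarrow> (nat \<Rightarrow> 'w \<Rightarrow> 'z) \<Rightarrow> (nat \<Rightarrow> nat \<Rightarrow> 'w \<Rightarrow> nat \<times> nat) \<Rightarrow> ('z \<Rightarrow> 'z \<Rightarrow> real) \<Rightarrow>
     'w \<Rightarrow> real" where
  "MoIU K M X J h \<omega> = sample_median (map (\<lambda>k. block_U M X J h k \<omega>) [1..<K+1])"

definition theta :: "'w measure \<Rightarrow> (nat \<Rightarrow> 'w \<Rightarrow> 'z) \<Rightarrow> ('z \<Rightarrow> 'z \<Rightarrow> real) \<Rightarrow> real" where
  "theta P X h = prob_space.expectation P (\<lambda>\<omega>. h (X 1 \<omega>) (X 2 \<omega>))"

definition sigma1_sq ::
  "'w measure \<Rightarrow> 'z measure \<Rightarrow> (nat \<Rightarrow> 'w \<Rightarrow> 'z) \<Rightarrow> ('z \<Rightarrow> 'z \<Rightarrow> real) \<Rightarrow> real" where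
  "sigma1_sq P Z X h =
     prob_space.variance P
       (real_cond_exp P (vimage_algebra (space P) (X 1) Z) (\<lambda>\<omega>. h (X 1 \<omega>) (X 2 \<omega>)))"

definition sigma_sq :: "'w measure \<Rightarrow> (nat \<Rightarrow> 'w \<Rightarrow> 'z) \<Rightarrow> ('z \<Rightarrow> 'z \<Rightarrow> real) \<Rightarrow> real" where
  "sigma_sq P X h = prob_space.variance P (\<lambda>\<omega>. h (X 1 \<omega>) (X 2 \<omega>))"

definition sigma2_sq ::
  "'w measure \<Rightarrow> 'z measure \<Rightarrow> (nat \<Rightarrow> 'w \<Rightarrow> 'z) \<Rightarrow> ('z \<Rightarrow> 'z \<Rightarrow> real) \<Rightarrow> real" where
  "sigma2_sq P Z X h = sigma_sq P X h - 2 * sigma1_sq P Z X h"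

definition g :: "real \<Rightarrow> real \<Rightarrow> real" where
  "g \<tau> \<delta> = 4 * \<tau> ^ 4 / (9 * (1/2 - \<tau>)\<^sup>2 * ln (2 / \<delta>))"

end

theory Submission
  imports Defs
begin

text \<open>
  Call a block of \<open>M\<close> pairs far if its mean differs from \<open>\<theta>\<close> by more than the claimed bound \<open>t\<close>, and
  let \<open>W\<close> be the conditional probability, given the sample, that a uniformly drawn block is far.
  If the median is off by more than \<open>t\<close>, then at least half of the \<open>K\<close> blocks are far, so either
  \<open>W \<ge> \<tau>\<close>, or the number of far blocks exceeds its conditional mean \<open>K W\<close> by \<open>K (1/2 - \<tau>)\<close>.
  By Chebyshev's inequality and the covariance structure of pairs the mean of \<open>W\<close> is at most \<open>\<tau>/3\<close>;
  \<open>W\<close> is a U-statistic of degree at most \<open>2 M\<close>, and Hoeffding's averaging argument bounds the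
  probability of the first event by \<open>\<delta>/2\<close>. For the second event the blocks are drawn one after the other: as
  \<open>K M\<^sup>2\<close> is small compared with the number of pairs, each block changes the conditional mean of the
  remaining sum by at most a constant, and Hoeffding's lemma applies at every step.
\<close>

subsection \<open>Injective maps between finite sets\<close>

text \<open>Given the sample, the far indicators of the blocks are dependent, and each is a function
  of a whole block. Hoeffding's comparison of sampling with and without replacement concerns sums
  over single draws, so a martingale over the blocks takes its place. Every step leaves the same
  problem with a smaller pool of pairs, hence the formulation by injective maps into an arbitrary
  finite set. A block moves its own term within an interval of length 1 and the total of the
  remaining means by at most 3/2 either way. Range 4 instead of 1 costs a factor 16 in the exponent:
  the tail is exp(-K s^2 / 8) with s = 1/2 - \<tau>, and the 8 in \<open>K\<close> brings it to
  \<delta>/2. For the other event the gap between \<tau> and the mean \<tau>/3 is 2\<tau>/3, so r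
  disjoint groups of 2 M sample points give exp(-2 r (2\<tau>/3)^2) = exp(-8 r \<tau>^2 / 9). With r
  = n / (2 M) the choice of \<open>M\<close> would make this exponent at least 2 log(2/\<delta>);
  the spare factor 2 pays for rounding r down.\<close>

definition inj_maps :: "'i set \<Rightarrow> 'a set \<Rightarrow> ('i \<Rightarrow> 'a) set" where
  "inj_maps S A = {f \<in> S \<rightarrow>\<^sub>E A. inj_on f S}"

lemma finite_inj_maps [simp]: "finite S \<Longrightarrow> finite A \<Longrightarrow> finite (inj_maps S A)"
  unfolding inj_maps_def by (rule finite_subset[OF _ finite_PiE[of S "\<lambda>_. A"]]) auto

lemma inj_maps_in: "f \<in> inj_maps S A \<Longrightarrow> i \<in> S \<Longrightarrow> f i \<in> A"
  by (auto simp: inj_maps_def)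

lemma inj_maps_mono: "A \<subseteq> B \<Longrightarrow> inj_maps S A \<subseteq> inj_maps S B"
  unfolding inj_maps_def by (blast dest: PiE_mono[of S "\<lambda>_. A" "\<lambda>_. B"])

lemma inj_maps_image_subset: "f \<in> inj_maps S A \<Longrightarrow> f ` S \<subseteq> A"
  by (auto simp: inj_maps_def)

lemma card_inj_maps_image: "f \<in> inj_maps S A \<Longrightarrow> card (f ` S) = card S"
  by (auto simp: inj_maps_def card_image)

lemma inj_maps_empty: "inj_maps {} A = {\<lambda>_. undefined}"
  by (auto simp: inj_maps_def)

text \<open>The part \<open>b\<close> on \<open>T\<close> is drawn first; the rest is then an
  injective family into the pool without the image of \<open>b\<close>. The counts below and the
  induction over blocks rest on this sequential view of sampling without replacement.\<close>

lemma sum_inj_maps_Un: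
  assumes "S \<inter> T = {}" "finite S" "finite T" "finite A"
  shows "(\<Sum>f\<in>inj_maps (S \<union> T) A. F f) =
    (\<Sum>b\<in>inj_maps T A. \<Sum>g\<in>inj_maps S (A - b ` T). F (merge T S (b, g)))"
proof -
  have "(\<Sum>b\<in>inj_maps T A. \<Sum>g\<in>inj_maps S (A - b ` T). F (merge T S (b, g)))
      = (\<Sum>(b, g)\<in>(SIGMA b:inj_maps T A. inj_maps S (A - b ` T)). F (merge T S (b, g)))"
    using assms by (subst sum.Sigma) auto
  also have "\<dots> = (\<Sum>f\<in>inj_maps (S \<union> T) A. F f)"
  proof (rule sum.reindex_bij_witness[where i = "\<lambda>f. (restrict f T, restrict f S)"
        and j = "\<lambda>p. merge T S p"])
    fix p assume "p \<in> (SIGMA b:inj_maps T A. inj_maps S (A - b ` T))"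
    then obtain b g where p: "p = (b, g)" "b \<in> inj_maps T A" "g \<in> inj_maps S (A - b ` T)" by auto
    have b: "restrict b T = b" and g: "restrict g S = g"
      using p by (auto simp: inj_maps_def)
    have d: "T \<inter> S = {}" using assms by auto
    show "(restrict (merge T S p) T, restrict (merge T S p) S) = p"
      using d b g by (simp add: p)
    have "merge T S p \<in> S \<union> T \<rightarrow>\<^sub>E A"
      using p(2,3) assms(1) by (auto simp: p(1) inj_maps_def merge_def PiE_iff extensional_def)
    moreover have "inj_on (merge T S p) (S \<union> T)"
    proof -
      have "inj_on (merge T S p) S = inj_on g S" "inj_on (merge T S p) T = inj_on b T"
        and im: "merge T S p ` S = g ` S" "merge T S p ` T = b ` T"
        using assms(1) by (auto intro!: inj_on_cong image_cong simp: p(1) merge_def)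
      moreover have "g ` S \<inter> b ` T = {}" "S - T = S" "T - S = T"
        using inj_maps_image_subset[OF p(3)] assms(1) by auto
      ultimately show ?thesis
        using p(2,3) by (simp add: inj_on_Un inj_maps_def)
    qed
    ultimately show "merge T S p \<in> inj_maps (S \<union> T) A"
      by (simp add: inj_maps_def)
  next
    fix f assume f: "f \<in> inj_maps (S \<union> T) A"
    show "merge T S (restrict f T, restrict f S) = f"
      using f by (auto simp: inj_maps_def merge_def fun_eq_iff PiE_iff extensional_def)
    have "inj_on f (S \<union> T)" "f \<in> (S \<union> T) \<rightarrow>\<^sub>E A" using f by (auto simp: inj_maps_def)
    then show "(restrict f T, restrict f S) \<in> (SIGMA b:inj_maps T A. inj_maps S (A - b ` T))"
      using assms(1) by (auto simp: inj_maps_def inj_on_def PiE_iff)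
  qed auto
  finally show ?thesis ..
qed

text \<open>Renames positions: families on the last block \<open>{Suc K} \<times> T\<close> become
  families on \<open>T\<close>.\<close>

lemma inj_maps_reindex:
  assumes "bij_betw u T T'"
  shows "(\<Sum>b\<in>inj_maps T' A. F (\<lambda>t\<in>T. b (u t))) = (\<Sum>b\<in>inj_maps T A. F b)"
proof (rule sum.reindex_bij_witness[where i = "\<lambda>b. \<lambda>t\<in>T'. b (the_inv_into T u t)"
      and j = "\<lambda>b. \<lambda>t\<in>T. b (u t)"])
  have inj: "inj_on u T" and im: "u ` T = T'" using assms by (auto simp: bij_betw_def)
  note [simp] = the_inv_into_f_f[OF inj]
  have inv: "bij_betw (the_inv_into T u) T' T" using assms by (rule bij_betw_the_inv_into)
  {
    fix b assume "b \<in> inj_maps T' A"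
    then have b: "b \<in> T' \<rightarrow>\<^sub>E A" "inj_on b T'" by (auto simp: inj_maps_def)
    show "(\<lambda>t\<in>T'. (\<lambda>t\<in>T. b (u t)) (the_inv_into T u t)) = b"
      using b im by (auto simp: fun_eq_iff PiE_iff extensional_def)
    show "(\<lambda>t\<in>T. b (u t)) \<in> inj_maps T A"
      using b im inj by (auto simp: inj_maps_def inj_on_def)
  }
  fix b assume "b \<in> inj_maps T A"
  then have b: "b \<in> T \<rightarrow>\<^sub>E A" "inj_on b T" by (auto simp: inj_maps_def)
  show "(\<lambda>t\<in>T. (\<lambda>t\<in>T'. b (the_inv_into T u t)) (u t)) = b"
    using b im by (auto simp: fun_eq_iff PiE_iff extensional_def)
  have "inj_on (\<lambda>t\<in>T'. b (the_inv_into T u t)) T'"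
    using b im inj by (auto simp: inj_on_def)
  then show "(\<lambda>t\<in>T'. b (the_inv_into T u t)) \<in> inj_maps T' A"
    using b im by (auto simp: inj_maps_def)
qed simp

text \<open>Renames values instead of positions. Applied to a permutation acting on index pairs, it
  says that the uniform law of a block does not change when the sample is relabelled.\<close>

lemma inj_maps_relabel:
  assumes "bij_betw \<phi> A A'"
  shows "(\<Sum>b\<in>inj_maps T A. F (\<lambda>t\<in>T. \<phi> (b t))) = (\<Sum>b\<in>inj_maps T A'. F b)"
proof (rule sum.reindex_bij_witness[where i = "\<lambda>b. \<lambda>t\<in>T. the_inv_into A \<phi> (b t)"
      and j = "\<lambda>b. \<lambda>t\<in>T. \<phi> (b t)"])
  have inj: "inj_on \<phi> A" and im: "\<phi> ` A = A'" using assms by (auto simp: bij_betw_def)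
  note [simp] = the_inv_into_f_f[OF inj]
  {
    fix b assume "b \<in> inj_maps T A"
    then have b: "b \<in> T \<rightarrow>\<^sub>E A" "inj_on b T" by (auto simp: inj_maps_def)
    show "(\<lambda>t\<in>T. the_inv_into A \<phi> ((\<lambda>t\<in>T. \<phi> (b t)) t)) = b"
      using b im by (auto simp: fun_eq_iff PiE_iff extensional_def)
    show "(\<lambda>t\<in>T. \<phi> (b t)) \<in> inj_maps T A'"
      using b im inj by (auto simp: inj_maps_def inj_on_def PiE_iff)
  }
  fix b assume "b \<in> inj_maps T A'"
  then have b: "b \<in> T \<rightarrow>\<^sub>E A'" "inj_on b T" by (auto simp: inj_maps_def)
  have fi: "\<phi> (the_inv_into A \<phi> y) = y" "the_inv_into A \<phi> y \<in> A" if "y \<in> A'" for y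
    using that im inj f_the_inv_into_f[OF inj] the_inv_into_into[OF inj] by auto
  show "(\<lambda>t\<in>T. \<phi> ((\<lambda>t\<in>T. the_inv_into A \<phi> (b t)) t)) = b"
    using b fi by (auto simp: fun_eq_iff PiE_iff extensional_def)
  have "inj_on (\<lambda>t\<in>T. the_inv_into A \<phi> (b t)) T"
  proof (rule inj_onI)
    fix s t assume st: "s \<in> T" "t \<in> T"
      "(\<lambda>t\<in>T. the_inv_into A \<phi> (b t)) s = (\<lambda>t\<in>T. the_inv_into A \<phi> (b t)) t"
    then have "\<phi> (the_inv_into A \<phi> (b s)) = \<phi> (the_inv_into A \<phi> (b t))" by simp
    moreover have "b s \<in> A'" "b t \<in> A'" using st b by auto
    ultimately have "b s = b t" using fi(1) by metis
    then show "s = t" using b st by (simp add: inj_on_def)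
  qed
  then show "(\<lambda>t\<in>T. the_inv_into A \<phi> (b t)) \<in> inj_maps T A"
    using b fi by (auto simp: inj_maps_def)
qed simp

lemma sum_inj_maps_insert:
  assumes "m \<notin> S" "finite S" "finite A"
  shows "(\<Sum>f\<in>inj_maps (insert m S) A. F f) =
    (\<Sum>e\<in>A. \<Sum>g\<in>inj_maps S (A - {e}). F (g(m := e)))"
proof -
  have "(\<Sum>f\<in>inj_maps (insert m S) A. F f) =
      (\<Sum>b\<in>inj_maps {m} A. \<Sum>g\<in>inj_maps S (A - b ` {m}). F (merge {m} S (b, g)))"
    using sum_inj_maps_Un[of S "{m}" A F] assms by simp
  also have "\<dots> = (\<Sum>e\<in>A. \<Sum>g\<in>inj_maps S (A - {e}). F (g(m := e)))"
  proof (rule sum.reindex_bij_witness[where j = "\<lambda>b. b m" and i = "\<lambda>e. \<lambda>t\<in>{m}. e"])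
    fix b assume "b \<in> inj_maps {m} A"
    then have b: "b \<in> {m} \<rightarrow>\<^sub>E A" by (simp add: inj_maps_def)
    then show "(\<lambda>t\<in>{m}. b m) = b" "b m \<in> A"
      by (auto simp: PiE_iff extensional_def fun_eq_iff)
    have "g(m := b m) = merge {m} S (b, g)" if "g \<in> inj_maps S (A - {b m})" for g
      using that assms(1) by (auto simp: fun_eq_iff merge_def inj_maps_def PiE_iff extensional_def)
    then show "(\<Sum>g\<in>inj_maps S (A - {b m}). F (g(m := b m))) =
        (\<Sum>g\<in>inj_maps S (A - b ` {m}). F (merge {m} S (b, g)))"
      by (intro sum.cong) auto
  qed (auto simp: inj_maps_def)
  finally show ?thesis .
qed

lemma card_inj_maps:
  assumes "finite S" "finite A"
  shows "card (inj_maps S A) = (\<Prod>i<card S. card A - i)"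
  using assms
proof (induction S arbitrary: A rule: finite_induct)
  case empty
  then show ?case by (simp add: inj_maps_empty)
next
  case (insert m S)
  have "card (inj_maps (insert m S) A) = (\<Sum>e\<in>A. card (inj_maps S (A - {e})))"
    using sum_inj_maps_insert[of m S A "\<lambda>_. 1 :: nat"] insert by simp
  also have "\<dots> = (\<Sum>e\<in>A. \<Prod>i<card S. card A - Suc i)"
    using insert by (intro sum.cong refl) (simp add: card_Diff_singleton)
  also have "\<dots> = (\<Prod>i<card (insert m S). card A - i)"
    using insert by (simp add: prod.lessThan_Suc_shift del: prod.lessThan_Suc)
  finally show ?case .
qed

lemma card_inj_maps_pos:
  assumes "finite S" "finite A" "card S \<le> card A"
  shows "0 < card (inj_maps S A)"
  using assms by (simp add: card_inj_maps prod_pos)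

text \<open>A single position is uniform on \<open>A\<close>, because the number \<open>c\<close> of
  completions does not depend on the value chosen there.\<close>

lemma sum_inj_maps_one:
  fixes \<phi> :: "'a \<Rightarrow> real"
  assumes "finite S" "finite A" "m \<in> S"
  shows "card A * (\<Sum>f\<in>inj_maps S A. \<phi> (f m)) = card (inj_maps S A) * (\<Sum>e\<in>A. \<phi> e)"
proof -
  define S' where "S' = S - {m}"
  define c where "c = (\<Prod>i<card S'. (card A - 1) - i)"
  have S: "S = insert m S'" "m \<notin> S'" "finite S'" using assms by (auto simp: S'_def)
  have c: "card (inj_maps S' (A - {e})) = c" if "e \<in> A" for e
    using that assms S by (simp add: card_inj_maps card_Diff_singleton c_def)
  have "(\<Sum>f\<in>inj_maps S A. \<phi> (f m)) = (\<Sum>e\<in>A. real c * \<phi> e)"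
    unfolding S(1) using S assms by (subst sum_inj_maps_insert) (auto simp: c intro!: sum.cong)
  moreover have "card (inj_maps S A) = card A * c"
    using sum_inj_maps_insert[of m S' A "\<lambda>_. 1 :: nat"] S assms by (simp add: c)
  ultimately show ?thesis by (simp flip: sum_distrib_left)
qed

text \<open>Two positions hold a uniform ordered pair of distinct points: fix the first value and
  apply \<open>sum_inj_maps_one\<close> to the pool without it.\<close>

lemma sum_inj_maps_two:
  fixes \<phi> :: "'a \<Rightarrow> 'a \<Rightarrow> real"
  assumes "finite S" "finite A" "m \<in> S" "m' \<in> S" "m \<noteq> m'"
  shows "(real (card A) * (real (card A) - 1)) * (\<Sum>f\<in>inj_maps S A. \<phi> (f m) (f m'))
    = card (inj_maps S A) * (\<Sum>e\<in>A. \<Sum>e'\<in>A - {e}. \<phi> e e')"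
proof -
  define S' where "S' = S - {m}"
  define c where "c = (\<Prod>i<card S'. (card A - 1) - i)"
  have S: "S = insert m S'" "m \<notin> S'" "finite S'" "m' \<in> S'" using assms by (auto simp: S'_def)
  have c: "card (inj_maps S' (A - {e})) = c" if "e \<in> A" for e
    using that assms S by (simp add: card_inj_maps card_Diff_singleton c_def)
  have "(real (card A) - 1) * (\<Sum>f\<in>inj_maps S A. \<phi> (f m) (f m'))
      = (real (card A) - 1) * (\<Sum>e\<in>A. \<Sum>g\<in>inj_maps S' (A - {e}). \<phi> e (g m'))"
    unfolding S(1) using S assms by (subst sum_inj_maps_insert) (auto intro!: sum.cong)
  also have "\<dots> = (\<Sum>e\<in>A. real (card (A - {e})) * (\<Sum>g\<in>inj_maps S' (A - {e}). \<phi> e (g m')))"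
    unfolding sum_distrib_left[of _ _ A]
  proof (intro sum.cong refl)
    fix e assume "e \<in> A"
    then have "real (card A) - 1 = real (card (A - {e}))"
      using assms card_Suc_Diff1[of A e] by linarith
    then show "(real (card A) - 1) * (\<Sum>g\<in>inj_maps S' (A - {e}). \<phi> e (g m'))
        = real (card (A - {e})) * (\<Sum>g\<in>inj_maps S' (A - {e}). \<phi> e (g m'))" by simp
  qed
  also have "\<dots> = (\<Sum>e\<in>A. real c * (\<Sum>e'\<in>A - {e}. \<phi> e e'))"
    by (intro sum.cong refl, subst sum_inj_maps_one) (use assms S c in auto)
  finally have "(real (card A) - 1) * (\<Sum>f\<in>inj_maps S A. \<phi> (f m) (f m'))
    = real c * (\<Sum>e\<in>A. \<Sum>e'\<in>A - {e}. \<phi> e e')" by (simp add: sum_distrib_left)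
  moreover have "card (inj_maps S A) = card A * c"
    using sum_inj_maps_insert[of m S' A "\<lambda>_. 1 :: nat"] S assms by (simp add: c)
  ultimately show ?thesis by simp
qed

subsection \<open>Blocks drawn without replacement\<close>

text \<open>The exponential is bounded, hence integrable, so the bound on its nonnegative integral
  passes to the real expectation.\<close>

lemma (in prob_space) Hoeffding_mgf_le:
  fixes f :: "'a \<Rightarrow> real"
  assumes [measurable]: "f \<in> borel_measurable M" and f: "\<And>x. x \<in> space M \<Longrightarrow> f x \<in> {a..b}"
    and "0 < l" and "expectation f = 0"
  shows "expectation (\<lambda>x. exp (l * f x)) \<le> exp (l\<^sup>2 * (b - a)\<^sup>2 / 8)"
proof -
  interpret interval_bounded_random_variable M f a b
    using f by unfold_locales auto
  have "integrable M (\<lambda>x. exp (l * f x))"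
  proof (rule integrable_const_bound[where B = "exp (l * b)"])
    show "AE x in M. norm (exp (l * f x)) \<le> exp (l * b)"
      using f \<open>0 < l\<close> by (intro AE_I2) auto
  qed simp
  then have "ennreal (expectation (\<lambda>x. exp (l * f x))) = (\<integral>\<^sup>+x. exp (l * f x) \<partial>M)"
    by (subst nn_integral_eq_integral) auto
  also have "\<dots> \<le> ennreal (exp (l\<^sup>2 * (b - a)\<^sup>2 / 8))"
    using assms by (intro Hoeffdings_lemma_nn_integral_0) auto
  finally show ?thesis by (simp add: ennreal_le_iff)
qed

lemma sum_exp_le_Hoeffding:
  fixes Y :: "'b \<Rightarrow> real"
  assumes "finite B" and Y: "\<And>x. x \<in> B \<Longrightarrow> Y x \<in> {a..b}" and "sum Y B = 0" and "0 < l"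
  shows "(\<Sum>x\<in>B. exp (l * Y x)) \<le> card B * exp (l\<^sup>2 * (b - a)\<^sup>2 / 8)"
proof (cases "B = {}")
  case False
  then obtain x0 where "x0 \<in> B" by auto
  \<comment> \<open>Hoeffding's lemma wants the bounds at every point of the space, also outside the
    support \<open>B\<close>; there \<open>Y'\<close> repeats a value taken in
    \<open>B\<close>.\<close>
  define Y' where "Y' x = (if x \<in> B then Y x else Y x0)" for x
  have "measure_pmf.expectation (pmf_of_set B) (\<lambda>x. exp (l * Y' x)) \<le> exp (l\<^sup>2 * (b - a)\<^sup>2 / 8)"
  proof (rule measure_pmf.Hoeffding_mgf_le)
    show "measure_pmf.expectation (pmf_of_set B) Y' = 0"
      using assms False by (simp add: integral_pmf_of_set Y'_def)
  qed (use Y \<open>x0 \<in> B\<close> \<open>0 < l\<close> in \<open>auto simp: Y'_def\<close>)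
  then have "(\<Sum>x\<in>B. exp (l * Y x)) / card B \<le> exp (l\<^sup>2 * (b - a)\<^sup>2 / 8)"
    using assms False by (simp add: integral_pmf_of_set Y'_def)
  then show ?thesis
    using assms False by (simp add: field_simps card_gt_0_iff)
qed simp

section \<open>Means over uniform injective families and their change under removal of a
  block\<close>

definition inj_mean :: "'i set \<Rightarrow> 'a set \<Rightarrow> (('i \<Rightarrow> 'a) \<Rightarrow> real) \<Rightarrow> real" where
  "inj_mean T A G = (\<Sum>b\<in>inj_maps T A. G b) / card (inj_maps T A)"

lemma inj_mean_unit:
  assumes "\<And>b. b \<in> inj_maps T A \<Longrightarrow> G b \<in> {0..1}"
  shows "inj_mean T A G \<in> {0..1}"
proof -
  have "0 \<le> (\<Sum>b\<in>inj_maps T A. G b)" using assms by (intro sum_nonneg) auto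
  moreover have "(\<Sum>b\<in>inj_maps T A. G b) \<le> (\<Sum>b\<in>inj_maps T A. 1)"
    using assms by (intro sum_mono) auto
  ultimately show ?thesis by (auto simp: inj_mean_def divide_le_eq_1 card_gt_0_iff)
qed

text \<open>Turns avoidance into a relation that is symmetric in \<open>b\<close> and
  \<open>c\<close>, as the double count in \<open>sum_inj_mean_Diff_image\<close> requires.\<close>

lemma inj_maps_Diff_image:
  "inj_maps T (A - b ` T) = {c \<in> inj_maps T A. b ` T \<inter> c ` T = {}}"
  by (auto simp: inj_maps_def PiE_iff) (metis imageI)

text \<open>A uniform family misses a given set of \<open>card T\<close> points up to probability \<open>(card T)\<^sup>2 / card A\<close>.\<close>

lemma inj_mean_Diff_image:
  assumes fin: "finite T" "finite A" and "T \<noteq> {}" and b: "b \<in> inj_maps T A"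
    and le: "2 * card T \<le> card A"
    and G: "\<And>b. b \<in> inj_maps T A \<Longrightarrow> G b \<in> {0..1}"
  shows "\<bar>inj_mean T (A - b ` T) G - inj_mean T A G\<bar> \<le> (card T)\<^sup>2 / card A"
proof -
  define B where "B = inj_maps T A"
  define B' where "B' = inj_maps T (A - b ` T)"
  have T: "card T > 0" using assms by (simp add: card_gt_0_iff)
  have A: "card A > 0" using T le by simp
  have fB: "finite B" "finite B'" and sub: "B' \<subseteq> B"
    using fin by (auto simp: B_def B'_def intro: inj_maps_mono[THEN subsetD])
  have cb: "card (b ` T) = card T" using b by (rule card_inj_maps_image)
  have bA: "b ` T \<subseteq> A" using b by (rule inj_maps_image_subset)
  have c: "card B > 0" "card B' > 0"
    unfolding B_def B'_def using fin le bA cb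
    by (auto intro!: card_inj_maps_pos simp: card_Diff_subset)
  have one: "real (card {f \<in> B. f m \<in> b ` T}) = card B * card T / card A" if "m \<in> T" for m
  proof -
    have "real (card {f \<in> B. f m \<in> b ` T}) = (\<Sum>f\<in>B. indicat_real (b ` T) (f m))"
      using fB by (simp add: indicator_def sum.If_cases Int_def)
    then have "card A * real (card {f \<in> B. f m \<in> b ` T}) = card B * (\<Sum>e\<in>A. indicat_real (b ` T) e)"
      unfolding B_def using sum_inj_maps_one[OF fin that, of "indicator (b ` T)"] by simp
    also have "(\<Sum>e\<in>A. indicat_real (b ` T) e) = card (A \<inter> b ` T)"
      using fin by (simp add: indicator_def sum.If_cases)
    also have "A \<inter> b ` T = b ` T" using bA by auto
    finally show ?thesis using A cb by (simp add: field_simps)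
  qed
  \<comment> \<open>Union bound over the position \<open>m\<close> at which a family hits the image
    of \<open>b\<close>.\<close>
  have "B - B' \<subseteq> (\<Union>m\<in>T. {f \<in> B. f m \<in> b ` T})"
    unfolding B'_def inj_maps_Diff_image B_def by auto (metis imageI)
  then have "card (B - B') \<le> card (\<Union>m\<in>T. {f \<in> B. f m \<in> b ` T})"
    using fB fin by (intro card_mono) auto
  also have "\<dots> \<le> (\<Sum>m\<in>T. card {f \<in> B. f m \<in> b ` T})"
    using fin(1) by (rule card_UN_le)
  finally have "real (card (B - B')) \<le> real (\<Sum>m\<in>T. card {f \<in> B. f m \<in> b ` T})"
    by (simp only: of_nat_le_iff)
  then have "real (card (B - B')) \<le> (\<Sum>m\<in>T. real (card {f \<in> B. f m \<in> b ` T}))"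
    by simp
  also have "\<dots> = card B * ((card T)\<^sup>2 / card A)"
    by (simp add: one power2_eq_square)
  finally have q: "real (card (B - B')) / card B \<le> (card T)\<^sup>2 / card A"
    using c by (simp add: field_simps)
  define S' S'' where "S' = sum G B'" and "S'' = sum G (B - B')"
  have S: "sum G B = S' + S''"
    using fB sub by (simp add: S'_def S''_def sum.subset_diff[of B' B])
  have cc: "real (card B) = card B' + card (B - B')"
    using fB sub by (simp add: card_Diff_subset card_mono of_nat_diff)
  have G0: "0 \<le> S'" "0 \<le> S''" using G sub by (auto simp: S'_def S''_def B_def intro!: sum_nonneg)
  have "S' \<le> (\<Sum>x\<in>B'. 1)" "S'' \<le> (\<Sum>x\<in>B - B'. 1)"
    unfolding S'_def S''_def using G sub by (intro sum_mono; force simp: B_def)+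
  then have G1: "S' \<le> card B'" "S'' \<le> card (B - B')" by simp_all
  have "inj_mean T (A - b ` T) G - inj_mean T A G
      = (S' * card (B - B') - S'' * card B') / (card B * card B')"
    using c by (simp add: inj_mean_def S flip: B_def B'_def S'_def) (simp add: cc field_simps)
  \<comment> \<open>Both products lie between 0 and the same bound, so their difference stays within
    it and no factor 2 is lost.\<close>
  moreover have "\<bar>S' * card (B - B') - S'' * card B'\<bar> \<le> card (B - B') * card B'"
  proof -
    have "0 \<le> S' * card (B - B')" "S' * card (B - B') \<le> card (B - B') * card B'"
      using G0 G1 mult_right_mono[OF G1(1), of "card (B - B')"] by (auto simp: mult.commute)
    moreover have "0 \<le> S'' * card B'" "S'' * card B' \<le> card (B - B') * card B'"
      using G0 G1 by (auto intro!: mult_right_mono)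
    ultimately show ?thesis by linarith
  qed
  then have "\<bar>(S' * card (B - B') - S'' * card B') / (card B * card B')\<bar> \<le> card (B - B') / card B"
    using c by (simp add: field_simps)
  ultimately show ?thesis using q by linarith
qed

text \<open>Every \<open>c\<close> is disjoint from the same number \<open>C\<close> of families
  \<open>b\<close>, so the double sum over disjoint pairs can be evaluated in either order. The
  means over the shrunken pools thus average to the original mean, which is the martingale property
  behind \<open>blocks_mgf\<close>.\<close>

lemma sum_inj_mean_Diff_image:
  assumes fin: "finite T" "finite A" and le: "2 * card T \<le> card A"
  shows "(\<Sum>b\<in>inj_maps T A. inj_mean T (A - b ` T) G) = card (inj_maps T A) * inj_mean T A G"
proof -
  define B where "B = inj_maps T A"
  define C where "C = (\<Prod>i<card T. card A - card T - i)"
  have C: "card (inj_maps T (A - b ` T)) = C" if "b \<in> B" for b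
    using that fin inj_maps_image_subset[of b T A]
    by (simp add: B_def C_def card_inj_maps card_Diff_subset card_inj_maps_image)
  have "C > 0" unfolding C_def using le by (intro prod_pos) auto
  have fB: "finite B" using fin by (simp add: B_def)
  have "(\<Sum>b\<in>B. inj_mean T (A - b ` T) G)
      = (\<Sum>b\<in>B. \<Sum>c | c \<in> B \<and> b ` T \<inter> c ` T = {}. G c) / C"
    by (simp add: inj_mean_def C sum_divide_distrib) (simp add: inj_maps_Diff_image B_def)
  also have "(\<Sum>b\<in>B. \<Sum>c | c \<in> B \<and> b ` T \<inter> c ` T = {}. G c)
      = (\<Sum>c\<in>B. \<Sum>b | b \<in> B \<and> b ` T \<inter> c ` T = {}. G c)"
    by (rule sum.swap_restrict[OF fB fB])
  also have "\<dots> = (\<Sum>c\<in>B. C * G c)"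
  proof (intro sum.cong refl)
    fix c assume "c \<in> B"
    have "{b \<in> B. b ` T \<inter> c ` T = {}} = inj_maps T (A - c ` T)"
      unfolding inj_maps_Diff_image B_def by auto
    then show "(\<Sum>b | b \<in> B \<and> b ` T \<inter> c ` T = {}. G c) = C * G c"
      using C[OF \<open>c \<in> B\<close>] by simp
  qed
  also have "\<dots> / C = sum G B" using \<open>C > 0\<close> by (simp flip: sum_distrib_left)
  also have "sum G B = card B * inj_mean T A G"
    using card_inj_maps_pos[OF fin] le by (simp add: inj_mean_def B_def)
  finally show ?thesis by (simp add: B_def)
qed

definition block :: "'i set \<Rightarrow> nat \<Rightarrow> (nat \<times> 'i \<Rightarrow> 'a) \<Rightarrow> 'i \<Rightarrow> 'a" where
  "block T k f = (\<lambda>t\<in>T. f (k, t))"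

text \<open>
  Drawing the last block shifts the mean of each remaining block by at most
  \<open>(card T)\<^sup>2 / card A\<close>, so its total influence on the sum has range at most 4, and Hoeffding's
  lemma applies to one block after the other.
\<close>

lemma blocks_mgf:
  fixes G :: "('i \<Rightarrow> 'a) \<Rightarrow> real" and K :: nat
  assumes "finite T" "T \<noteq> {}" "finite A" "0 < l"
    and G: "\<And>b. G b \<in> {0..1}"
    and "K * (card T)\<^sup>2 \<le> 3 / 2 * (card A - real K * card T)"
  shows "(\<Sum>f\<in>inj_maps ({1..K} \<times> T) A. exp (l * (\<Sum>k=1..K. G (block T k f) - inj_mean T A G)))
    \<le> card (inj_maps ({1..K} \<times> T) A) * exp (2 * real K * l\<^sup>2)"
  using assms(3,6)
proof (induction K arbitrary: A)
  case 0
  then show ?case by simp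
next
  case (Suc K)
  note fin = \<open>finite T\<close> \<open>finite A\<close>
  define \<mu> where "\<mu> = inj_mean T A G"
  \<comment> \<open>The martingale increment caused by the block \<open>b\<close>: its own centred
    value plus the change in the conditional mean of the \<open>K\<close> blocks that
    remain.\<close>
  define Y where "Y b = G b - \<mu> + K * (inj_mean T (A - b ` T) G - \<mu>)" for b
  define N where "N = {1..K} \<times> T"
  define C where "C = (\<Prod>i<card N. card A - card T - i)"
  have M: "card T > 0" using assms by (simp add: card_gt_0_iff)
  have cond: "(real K + 1) * (card T)\<^sup>2 \<le> 3 / 2 * (card A - (real K + 1) * card T)"
    using Suc.prems(2) by (simp add: algebra_simps)
  then have cond': "(real K + 1) * (card T)\<^sup>2 + 3 / 2 * ((real K + 1) * card T) \<le> 3 / 2 * card A"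
    by (simp add: algebra_simps)
  have "real (card T) \<le> (card T)\<^sup>2" using M by (simp add: power2_eq_square)
  then have "(real K + 1) * card T \<le> (real K + 1) * (card T)\<^sup>2" by (intro mult_left_mono) auto
  with cond' have KM: "(real K + 1) * card T * 5 / 3 \<le> card A" by linarith
  \<comment> \<open>For \<open>K = 0\<close> the pool left after one block may be too small for
    another, but then the shift in \<open>Y\<close> carries the factor 0.\<close>
  have two: "2 * card T \<le> card A" if "K > 0"
  proof -
    have "1 * real (card T) \<le> real K * card T" using that by (intro mult_right_mono) auto
    with KM have "2 * real (card T) \<le> card A" by (simp add: algebra_simps)
    then show ?thesis by linarith
  qed
  have TA: "card T \<le> card A"
  proof -
    have "0 \<le> real K * card T" by simp
    moreover have "real (card T) * 5 / 3 + real K * card T * 5 / 3 \<le> card A"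
      using KM by (simp add: algebra_simps)
    ultimately show ?thesis by linarith
  qed
  have A: "card A > 0" using TA M by linarith
  have C: "card (inj_maps N (A - b ` T)) = C" if "b \<in> inj_maps T A" for b
    using that fin inj_maps_image_subset[of b T A]
    by (simp add: N_def C_def card_inj_maps card_Diff_subset card_inj_maps_image)
  have \<mu>: "\<mu> \<in> {0..1}" unfolding \<mu>_def using G by (intro inj_mean_unit) auto
  have Y: "Y b \<in> {- \<mu> - 3 / 2..1 - \<mu> + 3 / 2}" if b: "b \<in> inj_maps T A" for b
  proof -
    have "\<bar>K * (inj_mean T (A - b ` T) G - \<mu>)\<bar> \<le> 3 / 2"
    proof (cases "K = 0")
      case False
      then have "\<bar>inj_mean T (A - b ` T) G - \<mu>\<bar> \<le> (card T)\<^sup>2 / card A"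
        unfolding \<mu>_def using G b two fin assms(2) by (intro inj_mean_Diff_image) auto
      then have "K * \<bar>inj_mean T (A - b ` T) G - \<mu>\<bar> \<le> K * ((card T)\<^sup>2 / card A)"
        by (intro mult_left_mono) auto
      also have "\<dots> = K * (card T)\<^sup>2 / card A" by simp
      also have "K * (card T)\<^sup>2 \<le> 3 / 2 * real (card A)"
      proof -
        have "0 \<le> (real (card T))\<^sup>2" "0 \<le> (real K + 1) * card T" by auto
        moreover have "(real K + 1) * (card T)\<^sup>2 = K * (card T)\<^sup>2 + (real (card T))\<^sup>2"
          by (simp add: algebra_simps)
        ultimately show ?thesis using cond' by linarith
      qed
      finally have "real K * \<bar>inj_mean T (A - b ` T) G - \<mu>\<bar> \<le> 3 / 2"
        using A by (simp add: divide_right_mono)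
      then show ?thesis by (simp add: abs_mult)
    qed simp
    then show ?thesis using G[of b] unfolding Y_def by auto
  qed
  have sumY: "sum Y (inj_maps T A) = 0"
  proof -
    have c: "card (inj_maps T A) > 0" using fin TA by (intro card_inj_maps_pos)
    have "(\<Sum>b\<in>inj_maps T A. G b - \<mu>) = 0"
      using c by (simp add: sum_subtractf \<mu>_def inj_mean_def)
    moreover have "(\<Sum>b\<in>inj_maps T A. K * (inj_mean T (A - b ` T) G - \<mu>)) = 0"
    proof (cases "K = 0")
      case False
      then show ?thesis
        using sum_inj_mean_Diff_image[OF fin, of G] two
        by (simp add: sum_subtractf \<mu>_def flip: sum_distrib_left)
    qed simp
    ultimately show ?thesis unfolding Y_def by (simp add: sum.distrib)
  qed
  have split: "{1..Suc K} \<times> T = N \<union> {Suc K} \<times> T" "N \<inter> {Suc K} \<times> T = {}"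
    by (auto simp: N_def le_Suc_eq)
  have finN: "finite N" using fin by (simp add: N_def)
  have bij: "bij_betw (\<lambda>t. (Suc K, t)) T ({Suc K} \<times> T)"
    by (auto simp: bij_betw_def inj_on_def)
  \<comment> \<open>Kept general in \<open>F\<close> because the constant function 1 is inserted
    later to count the families.\<close>
  have decomp: "(\<Sum>f\<in>inj_maps ({1..Suc K} \<times> T) A. F f) =
      (\<Sum>b\<in>inj_maps T A. \<Sum>g\<in>inj_maps N (A - b ` T). F' b g)"
    if F: "\<And>b g. b \<in> inj_maps ({Suc K} \<times> T) A \<Longrightarrow>
      F (merge ({Suc K} \<times> T) N (b, g)) = F' (\<lambda>t\<in>T. b (Suc K, t)) g" for F and F' :: "_ \<Rightarrow> _ \<Rightarrow> real"
  proof -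
    have "(\<Sum>f\<in>inj_maps ({1..Suc K} \<times> T) A. F f) =
        (\<Sum>b\<in>inj_maps ({Suc K} \<times> T) A. \<Sum>g\<in>inj_maps N (A - b ` ({Suc K} \<times> T)).
          F' (\<lambda>t\<in>T. b (Suc K, t)) g)"
      unfolding split(1) using fin
      by (subst sum_inj_maps_Un[OF split(2)]) (simp_all add: F finN)
    also have "\<dots> = (\<Sum>b\<in>inj_maps ({Suc K} \<times> T) A. \<Sum>g\<in>inj_maps N (A - (\<lambda>t\<in>T. b (Suc K, t)) ` T).
          F' (\<lambda>t\<in>T. b (Suc K, t)) g)"
      by (intro sum.cong arg_cong2[of _ _ _ _ inj_maps] arg_cong2[of _ _ _ _ "(-)"] refl) force
    also have "\<dots> = (\<Sum>b\<in>inj_maps T A. \<Sum>g\<in>inj_maps N (A - b ` T). F' b g)"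
      by (rule inj_maps_reindex[OF bij, of "\<lambda>b. \<Sum>g\<in>inj_maps N (A - b ` T). F' b g"])
    finally show ?thesis .
  qed
  have "(\<Sum>f\<in>inj_maps ({1..Suc K} \<times> T) A. exp (l * (\<Sum>k=1..Suc K. G (block T k f) - \<mu>))) =
      (\<Sum>b\<in>inj_maps T A. \<Sum>g\<in>inj_maps N (A - b ` T).
        exp (l * (G b - \<mu> + (\<Sum>k=1..K. G (block T k g) - \<mu>))))"
  proof (rule decomp)
    fix b g assume "b \<in> inj_maps ({Suc K} \<times> T) A"
    have "block T k (merge ({Suc K} \<times> T) N (b, g)) = block T k g" if "k \<in> {1..K}" for k
      using that by (auto simp: block_def merge_def N_def fun_eq_iff)
    moreover have "block T (Suc K) (merge ({Suc K} \<times> T) N (b, g)) = (\<lambda>t\<in>T. b (Suc K, t))"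
      by (auto simp: block_def merge_def fun_eq_iff)
    ultimately show "exp (l * (\<Sum>k=1..Suc K. G (block T k (merge ({Suc K} \<times> T) N (b, g))) - \<mu>)) =
        exp (l * (G (\<lambda>t\<in>T. b (Suc K, t)) - \<mu> + (\<Sum>k=1..K. G (block T k g) - \<mu>)))"
      by simp
  qed
  also have "\<dots> \<le> (\<Sum>b\<in>inj_maps T A. exp (l * Y b) * (C * exp (2 * real K * l\<^sup>2)))"
  proof (intro sum_mono)
    fix b assume b: "b \<in> inj_maps T A"
    define \<mu>' where "\<mu>' = inj_mean T (A - b ` T) G"
    \<comment> \<open>Removing a block takes \<open>card T\<close> from the pool and also from the
      points still to be drawn. The difference on the right of the hypothesis is therefore unchanged
      while its left side decreases, so the hypothesis is inherited by the smaller pool.\<close>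
    have cA: "real (card (A - b ` T)) = real (card A) - card T"
      using b fin TA inj_maps_image_subset[of b T A]
      by (simp add: card_Diff_subset card_inj_maps_image of_nat_diff)
    define c2 where "c2 = (real (card T))\<^sup>2"
    define kc where "kc = real K * card T"
    have "(real K + 1) * c2 = real K * c2 + c2" "(real K + 1) * card T = kc + card T"
      by (simp_all add: algebra_simps kc_def)
    with cond have "real K * c2 + c2 \<le> 3 / 2 * (real (card A) - (kc + card T))"
      by (simp add: c2_def)
    moreover have "0 \<le> c2" by (simp add: c2_def)
    ultimately have "real K * c2 \<le> 3 / 2 * (real (card A) - card T - kc)" by simp
    then have "K * (card T)\<^sup>2 \<le> 3 / 2 * (card (A - b ` T) - real K * card T)"
      by (simp add: cA c2_def kc_def)
    note IH = Suc.IH[OF _ this]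
    \<comment> \<open>The induction hypothesis centres at the mean \<mu>' of the smaller pool; the
      correction, \<open>K\<close> times \<mu>' - \<mu>, is what \<open>Y b\<close>
      contains.\<close>
    have "(\<Sum>g\<in>inj_maps N (A - b ` T). exp (l * (G b - \<mu> + (\<Sum>k=1..K. G (block T k g) - \<mu>))))
        = (\<Sum>g\<in>inj_maps N (A - b ` T). exp (l * Y b) * exp (l * (\<Sum>k=1..K. G (block T k g) - \<mu>')))"
      by (intro sum.cong refl)
        (simp add: Y_def \<mu>'_def sum_subtractf algebra_simps flip: exp_add)
    also have "\<dots> \<le> exp (l * Y b) * (card (inj_maps N (A - b ` T)) * exp (2 * real K * l\<^sup>2))"
      unfolding sum_distrib_left[symmetric] \<mu>'_def N_def
      by (intro mult_left_mono IH) (use fin in auto)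
    finally show "(\<Sum>g\<in>inj_maps N (A - b ` T). exp (l * (G b - \<mu> + (\<Sum>k=1..K. G (block T k g) - \<mu>))))
        \<le> exp (l * Y b) * (C * exp (2 * real K * l\<^sup>2))"
      using C[OF b] by simp
  qed
  also have "\<dots> = (\<Sum>b\<in>inj_maps T A. exp (l * Y b)) * (C * exp (2 * real K * l\<^sup>2))"
    by (simp add: sum_distrib_right)
  \<comment> \<open>The interval has length 4, and 4^2 / 8 = 2 is the coefficient of
    \<open>l\<^sup>2\<close> contributed by each block.\<close>
  also have "\<dots> \<le> (card (inj_maps T A) * exp (l\<^sup>2 * ((1 - \<mu> + 3 / 2) - (- \<mu> - 3 / 2))\<^sup>2 / 8))
      * (C * exp (2 * real K * l\<^sup>2))"
    using Y sumY \<open>0 < l\<close> fin by (intro mult_right_mono sum_exp_le_Hoeffding) auto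
  also have "\<dots> = (card (inj_maps T A) * C) * exp (2 * real (Suc K) * l\<^sup>2)"
    by (simp add: algebra_simps flip: exp_add)
  also have "real (card (inj_maps T A) * C) = card (inj_maps ({1..Suc K} \<times> T) A)"
    using decomp[of "\<lambda>_. 1" "\<lambda>_ _. 1"] by (simp add: C)
  finally show ?case by (simp add: \<mu>_def)
qed

lemma blocks_tail:
  fixes G :: "('i \<Rightarrow> 'a) \<Rightarrow> real" and K :: nat and s :: real
  assumes "finite T" "T \<noteq> {}" "finite A" "0 < s"
    and G: "\<And>b. G b \<in> {0..1}"
    and "K * (card T)\<^sup>2 \<le> 3 / 2 * (card A - real K * card T)"
  shows "card {f \<in> inj_maps ({1..K} \<times> T) A. K * (inj_mean T A G + s) \<le> (\<Sum>k=1..K. G (block T k f))}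
    \<le> card (inj_maps ({1..K} \<times> T) A) * exp (- real K * s\<^sup>2 / 8)"
proof -
  define F where "F = inj_maps ({1..K} \<times> T) A"
  define E where "E = {f \<in> F. K * (inj_mean T A G + s) \<le> (\<Sum>k=1..K. G (block T k f))}"
  \<comment> \<open>The minimiser of 2 K l^2 - K s l; the minimum is -K s^2 / 8.\<close>
  define l where "l = s / 4"
  have "finite F" using assms by (simp add: F_def)
  have "real (card E) * exp (l * (K * s)) = (\<Sum>f\<in>E. exp (l * (K * s)))" by simp
  also have "\<dots> \<le> (\<Sum>f\<in>E. exp (l * (\<Sum>k=1..K. G (block T k f) - inj_mean T A G)))"
  proof (intro sum_mono)
    fix f assume "f \<in> E"
    then have "K * s \<le> (\<Sum>k=1..K. G (block T k f) - inj_mean T A G)"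
      by (simp add: E_def sum_subtractf algebra_simps)
    then show "exp (l * (K * s)) \<le> exp (l * (\<Sum>k=1..K. G (block T k f) - inj_mean T A G))"
      using \<open>0 < s\<close> by (simp add: l_def)
  qed
  also have "\<dots> \<le> (\<Sum>f\<in>F. exp (l * (\<Sum>k=1..K. G (block T k f) - inj_mean T A G)))"
    using \<open>finite F\<close> by (intro sum_mono2) (auto simp: E_def)
  also have "\<dots> \<le> card F * exp (2 * real K * l\<^sup>2)"
    unfolding F_def using assms by (intro blocks_mgf) (auto simp: l_def)
  finally have "card E \<le> card F * exp (2 * real K * l\<^sup>2) / exp (l * (K * s))"
    by (simp add: field_simps)
  also have "\<dots> = card F * exp (2 * real K * l\<^sup>2 - l * (K * s))" by (simp add: exp_diff)
  also have "2 * real K * l\<^sup>2 - l * (K * s) = - real K * s\<^sup>2 / 8"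
    by (simp add: l_def power2_eq_square)
  finally show ?thesis by (simp add: E_def F_def)
qed

subsection \<open>Covariances over pairs of sample points\<close>

lemma card_index_pairs: "2 * card (index_pairs n) = n * (n - 1)"
proof (induction n)
  case 0
  have "index_pairs 0 = {}" by (auto simp: index_pairs_def)
  then show ?case by simp
next
  case (Suc n)
  have "index_pairs (Suc n) = index_pairs n \<union> (\<lambda>i. (i, Suc n)) ` {1..n}"
    by (auto simp: index_pairs_def le_Suc_eq image_iff)
  moreover have "index_pairs n \<inter> (\<lambda>i. (i, Suc n)) ` {1..n} = {}"
    by (auto simp: index_pairs_def)
  moreover have "finite (index_pairs n)"
    by (rule finite_subset[of _ "{1..n} \<times> {1..n}"]) (auto simp: index_pairs_def)
  moreover have "card ((\<lambda>i. (i, Suc n)) ` {1..n}) = n"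
    by (subst card_image) (auto simp: inj_on_def)
  ultimately have "card (index_pairs (Suc n)) = card (index_pairs n) + n"
    by (simp add: card_Un_disjoint)
  then show ?case using Suc by (cases n) (auto simp: algebra_simps)
qed

lemma finite_index_pairs [simp]: "finite (index_pairs n)"
  by (rule finite_subset[of _ "{1..n} \<times> {1..n}"]) (auto simp: index_pairs_def)

text \<open>The block mean as a function of given draws \<open>b\<close> and a given sample
  \<open>x\<close>, so that the two sources of randomness can be treated separately.\<close>

definition pair_mean :: "nat \<Rightarrow> ('z \<Rightarrow> 'z \<Rightarrow> real) \<Rightarrow> (nat \<Rightarrow> nat \<times> nat) \<Rightarrow> (nat \<Rightarrow> 'z) \<Rightarrow> real" where
  "pair_mean M h b x = (\<Sum>m = 1..M. h (x (fst (b m))) (x (snd (b m)))) / real M"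

lemma integrable_mult_square:
  fixes f f' :: "'a \<Rightarrow> real"
  assumes [measurable]: "f \<in> borel_measurable N" "f' \<in> borel_measurable N"
    and "integrable N (\<lambda>x. (f x)\<^sup>2)" "integrable N (\<lambda>x. (f' x)\<^sup>2)"
  shows "integrable N (\<lambda>x. f x * f' x)"
proof (rule Bochner_Integration.integrable_bound)
  show "integrable N (\<lambda>x. (f x)\<^sup>2 + (f' x)\<^sup>2)" using assms by simp
  have "\<bar>a * b\<bar> \<le> a\<^sup>2 + b\<^sup>2" for a b :: real
    using zero_le_power2[of "a + b"] zero_le_power2[of "a - b"] zero_le_power2[of a] zero_le_power2[of b]
    unfolding power2_sum power2_diff abs_le_iff by linarith
  then show "AE x in N. norm (f x * f' x) \<le> norm ((f x)\<^sup>2 + (f' x)\<^sup>2)" by auto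
qed measurable

text \<open>The canonical model: \<mu> is the law of one observation, and the sample is a point of
  the product space \<open>D\<close>. Three indices are needed for two pairs that share one point,
  and n - 2 > 0 enters the average of the covariances.\<close>

locale kernel_sample = prob_space \<mu> for \<mu> :: "'z measure" +
  fixes n :: nat and h :: "'z \<Rightarrow> 'z \<Rightarrow> real"
  assumes n3: "3 \<le> n"
    and h_borel: "(\<lambda>(x, y). h x y) \<in> borel_measurable (\<mu> \<Otimes>\<^sub>M \<mu>)"
    and h_sym: "\<And>x y. x \<in> space \<mu> \<Longrightarrow> y \<in> space \<mu> \<Longrightarrow> h x y = h y x"
    and h_sq: "integrable (\<mu> \<Otimes>\<^sub>M \<mu>) (\<lambda>(x, y). (h x y)\<^sup>2)"
begin

definition D :: "(nat \<Rightarrow> 'z) measure" where "D = PiM {1..n} (\<lambda>_. \<mu>)"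

sublocale D: prob_space D
  unfolding D_def by (intro prob_space_PiM prob_space_axioms)

sublocale pp: pair_prob_space \<mu> \<mu> ..

lemma space_D: "x \<in> space D \<Longrightarrow> i \<in> {1..n} \<Longrightarrow> x i \<in> space \<mu>"
  by (auto simp: D_def space_PiM)

lemma h_measurable [measurable (raw)]:
  assumes "f \<in> measurable N \<mu>" "f' \<in> measurable N \<mu>"
  shows "(\<lambda>x. h (f x) (f' x)) \<in> borel_measurable N"
  using measurable_compose[OF measurable_Pair[OF assms] h_borel] by simp

lemma coord_measurable [measurable]: "i \<in> {1..n} \<Longrightarrow> (\<lambda>x. x i) \<in> measurable D \<mu>"
  unfolding D_def by (rule measurable_component_singleton)

lemma distr_D_reindex:
  assumes "inj_on f {1..n}" "f \<in> {1..n} \<rightarrow> {1..n}"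
  shows "distr D D (\<lambda>x. \<lambda>i\<in>{1..n}. x (f i)) = D"
  unfolding D_def using distr_PiM_reindex[of "{1..n}" "\<lambda>_. \<mu>", OF _ assms] prob_space_axioms by simp

lemma indep_coords: "D.indep_vars (\<lambda>_. \<mu>) (\<lambda>i x. x i) {1..n}"
proof (subst D.indep_vars_iff_distr_eq_PiM')
  have "distr D D (\<lambda>x. \<lambda>i\<in>{1..n}. x i) = D"
    using distr_D_reindex[of "\<lambda>i. i"] by simp
  moreover have "distr D \<mu> (\<lambda>x. x i) = \<mu>" if "i \<in> {1..n}" for i
    unfolding D_def using that by (intro distr_PiM_component prob_space_axioms) auto
  then have "PiM {1..n} (\<lambda>i. distr D \<mu> (\<lambda>x. x i)) = D"
    unfolding D_def by (intro PiM_cong) auto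
  ultimately show "distr D (PiM {1..n} (\<lambda>_. \<mu>)) (\<lambda>x. \<lambda>i\<in>{1..n}. x i)
      = PiM {1..n} (\<lambda>i. distr D \<mu> (\<lambda>x. x i))"
    by (simp add: D_def)
qed (use n3 in auto)

lemma indep_var_coords:
  assumes "A \<inter> B = {}" "A \<subseteq> {1..n}" "B \<subseteq> {1..n}"
    and f: "f \<in> measurable (PiM A (\<lambda>_. \<mu>)) N" "\<And>x. f (restrict x A) = f x"
    and f': "f' \<in> measurable (PiM B (\<lambda>_. \<mu>)) L" "\<And>x. f' (restrict x B) = f' x"
  shows "D.indep_var N f L f'"
  using D.indep_var_compose[OF D.indep_var_restrict[OF indep_coords assms(1-3)] f(1) f'(1)]
  by (simp add: comp_def f(2) f'(2))

lemma distr_coord: "i \<in> {1..n} \<Longrightarrow> distr D \<mu> (\<lambda>x. x i) = \<mu>"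
  unfolding D_def by (intro distr_PiM_component prob_space_axioms) auto

text \<open>The restrictions to disjoint index sets have a product law, which is then pushed forward
  in each factor. Arbitrary target spaces allow iteration: for three coordinates the second
  component is itself a pair.\<close>

lemma distr_pair_coords:
  assumes AB: "A \<inter> B = {}" "A \<subseteq> {1..n}" "B \<subseteq> {1..n}"
    and f [measurable]: "f \<in> measurable (PiM A (\<lambda>_. \<mu>)) N" and fr: "\<And>x. f (restrict x A) = f x"
    and f' [measurable]: "f' \<in> measurable (PiM B (\<lambda>_. \<mu>)) L" and f'r: "\<And>x. f' (restrict x B) = f' x"
  shows "distr D (N \<Otimes>\<^sub>M L) (\<lambda>x. (f x, f' x)) = distr D N f \<Otimes>\<^sub>M distr D L f'"
proof -
  define a where "a x = restrict x A" for x :: "nat \<Rightarrow> 'z"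
  define b where "b x = restrict x B" for x :: "nat \<Rightarrow> 'z"
  have a [measurable]: "a \<in> measurable D (PiM A (\<lambda>_. \<mu>))"
    and b [measurable]: "b \<in> measurable D (PiM B (\<lambda>_. \<mu>))"
    unfolding a_def b_def D_def using AB by (auto intro!: measurable_restrict_subset)
  have eq: "f \<circ> a = f" "f' \<circ> b = f'" by (auto simp: a_def b_def fr f'r)
  then have [measurable]: "f \<in> measurable D N" "f' \<in> measurable D L"
    using measurable_comp[OF a f] measurable_comp[OF b f'] by simp_all
  have "D.indep_var (PiM A (\<lambda>_. \<mu>)) a (PiM B (\<lambda>_. \<mu>)) b"
    unfolding a_def b_def using D.indep_var_restrict[OF indep_coords AB] by simp
  then have ab: "distr D (PiM A (\<lambda>_. \<mu>)) a \<Otimes>\<^sub>M distr D (PiM B (\<lambda>_. \<mu>)) b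
      = distr D (PiM A (\<lambda>_. \<mu>) \<Otimes>\<^sub>M PiM B (\<lambda>_. \<mu>)) (\<lambda>x. (a x, b x))"
    by (simp add: D.indep_var_distribution_eq)
  interpret L: prob_space "distr D L f'" by (rule D.prob_space_distr) simp
  have sf: "sigma_finite_measure (distr (distr D (PiM B (\<lambda>_. \<mu>)) b) L f')"
    using L.sigma_finite_measure_axioms by (simp add: distr_distr eq)
  have "distr D N f \<Otimes>\<^sub>M distr D L f'
      = distr (distr D (PiM A (\<lambda>_. \<mu>)) a) N f \<Otimes>\<^sub>M distr (distr D (PiM B (\<lambda>_. \<mu>)) b) L f'"
    by (simp add: distr_distr eq)
  also have "\<dots> = distr (distr D (PiM A (\<lambda>_. \<mu>) \<Otimes>\<^sub>M PiM B (\<lambda>_. \<mu>)) (\<lambda>x. (a x, b x)))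
      (N \<Otimes>\<^sub>M L) (\<lambda>(x, y). (f x, f' y))"
    using sf by (subst pair_measure_distr) (auto simp: ab)
  also have "\<dots> = distr D (N \<Otimes>\<^sub>M L) (\<lambda>x. (f x, f' x))"
    using eq by (subst distr_distr) (auto simp: comp_def fun_eq_iff)
  finally show ?thesis ..
qed

lemma distr_coord2:
  assumes "i \<in> {1..n}" "j \<in> {1..n}" "i \<noteq> j"
  shows "distr D (\<mu> \<Otimes>\<^sub>M \<mu>) (\<lambda>x. (x i, x j)) = \<mu> \<Otimes>\<^sub>M \<mu>"
  using distr_pair_coords[of "{i}" "{j}" "\<lambda>x. x i" \<mu> "\<lambda>x. x j" \<mu>] assms
  by (simp add: distr_coord)

lemma distr_coord3:
  assumes "i \<in> {1..n}" "j \<in> {1..n}" "k \<in> {1..n}" "i \<noteq> j" "i \<noteq> k" "j \<noteq> k"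
  shows "distr D (\<mu> \<Otimes>\<^sub>M (\<mu> \<Otimes>\<^sub>M \<mu>)) (\<lambda>x. (x i, x j, x k)) = \<mu> \<Otimes>\<^sub>M (\<mu> \<Otimes>\<^sub>M \<mu>)"
  using distr_pair_coords[of "{i}" "{j, k}" "\<lambda>x. x i" \<mu> "\<lambda>x. (x j, x k)" "\<mu> \<Otimes>\<^sub>M \<mu>"] assms
  by (simp add: distr_coord distr_coord2)

definition mean :: real where "mean = (\<integral>(x, y). h x y \<partial>(\<mu> \<Otimes>\<^sub>M \<mu>))"
definition h0 :: "'z \<Rightarrow> 'z \<Rightarrow> real" where "h0 x y = h x y - mean"
text \<open>The first Hoeffding projection of the centred kernel. At points where the section is not
  integrable the integral is 0 by convention, so later identities for it are claimed only almost
  everywhere.\<close>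

definition h1 :: "'z \<Rightarrow> real" where "h1 x = (\<integral>y. h0 x y \<partial>\<mu>)"
definition var :: real where "var = (\<integral>(x, y). (h0 x y)\<^sup>2 \<partial>(\<mu> \<Otimes>\<^sub>M \<mu>))"
definition var1 :: real where "var1 = (\<integral>x. (h1 x)\<^sup>2 \<partial>\<mu>)"

lemma h0_measurable [measurable (raw)]:
  assumes [measurable]: "f \<in> measurable N \<mu>" "f' \<in> measurable N \<mu>"
  shows "(\<lambda>x. h0 (f x) (f' x)) \<in> borel_measurable N"
  unfolding h0_def by measurable

lemma h_integrable: "integrable (\<mu> \<Otimes>\<^sub>M \<mu>) (\<lambda>p. h (fst p) (snd p))"
proof (rule Bochner_Integration.integrable_bound)
  show "integrable (\<mu> \<Otimes>\<^sub>M \<mu>) (\<lambda>p. 1 + (h (fst p) (snd p))\<^sup>2)"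
    using h_sq by (auto simp: case_prod_unfold)
  have "\<bar>a\<bar> \<le> 1 + a\<^sup>2" for a :: real
    using zero_le_power2[of "\<bar>a\<bar> - 1"] by (simp add: power2_diff)
  then show "AE p in \<mu> \<Otimes>\<^sub>M \<mu>. norm (h (fst p) (snd p)) \<le> norm (1 + (h (fst p) (snd p))\<^sup>2)"
    by auto
qed measurable

lemma h0_integrable: "integrable (\<mu> \<Otimes>\<^sub>M \<mu>) (\<lambda>p. h0 (fst p) (snd p))"
  unfolding h0_def by (intro Bochner_Integration.integrable_diff h_integrable) simp

lemma h0_sq_integrable: "integrable (\<mu> \<Otimes>\<^sub>M \<mu>) (\<lambda>p. (h0 (fst p) (snd p))\<^sup>2)"
  unfolding h0_def power2_diff using h_integrable h_sq
  by (auto simp: case_prod_unfold)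

lemma h0_mean: "(\<integral>p. h0 (fst p) (snd p) \<partial>(\<mu> \<Otimes>\<^sub>M \<mu>)) = 0"
  unfolding h0_def using h_integrable
  by (simp add: mean_def case_prod_unfold pp.P.prob_space)

lemma h0_sq_D:
  assumes "i \<in> {1..n}" "j \<in> {1..n}" "i \<noteq> j"
  shows "integrable D (\<lambda>x. (h0 (x i) (x j))\<^sup>2)" "D.expectation (\<lambda>x. (h0 (x i) (x j))\<^sup>2) = var"
proof -
  have "(\<lambda>x. (x i, x j)) \<in> measurable D (\<mu> \<Otimes>\<^sub>M \<mu>)" using assms by measurable
  from integrable_distr_eq[OF this, of "\<lambda>p. (h0 (fst p) (snd p))\<^sup>2"]
    integral_distr[OF this, of "\<lambda>p. (h0 (fst p) (snd p))\<^sup>2"]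
  show "integrable D (\<lambda>x. (h0 (x i) (x j))\<^sup>2)" "D.expectation (\<lambda>x. (h0 (x i) (x j))\<^sup>2) = var"
    using h0_sq_integrable unfolding distr_coord2[OF assms] by (simp_all add: var_def case_prod_unfold)
qed

lemma h0_D:
  assumes "i \<in> {1..n}" "j \<in> {1..n}" "i \<noteq> j"
  shows "integrable D (\<lambda>x. h0 (x i) (x j))" "D.expectation (\<lambda>x. h0 (x i) (x j)) = 0"
proof -
  have "(\<lambda>x. (x i, x j)) \<in> measurable D (\<mu> \<Otimes>\<^sub>M \<mu>)" using assms by measurable
  from integrable_distr_eq[OF this, of "\<lambda>p. h0 (fst p) (snd p)"]
    integral_distr[OF this, of "\<lambda>p. h0 (fst p) (snd p)"]
  show "integrable D (\<lambda>x. h0 (x i) (x j))" "D.expectation (\<lambda>x. h0 (x i) (x j)) = 0"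
    using h0_integrable h0_mean unfolding distr_coord2[OF assms] by simp_all
qed

lemma h0_mult_integrable:
  assumes "i \<in> {1..n}" "j \<in> {1..n}" "i \<noteq> j" "k \<in> {1..n}" "l \<in> {1..n}" "k \<noteq> l"
  shows "integrable D (\<lambda>x. h0 (x i) (x j) * h0 (x k) (x l))"
  using assms by (intro integrable_mult_square h0_sq_D) measurable

text \<open>Given the shared point, the two factors are independent with the same conditional mean
  \<open>h1\<close>, so the covariance is the second moment of \<open>h1\<close>.\<close>

lemma cov_one:
  assumes "i \<in> {1..n}" "j \<in> {1..n}" "k \<in> {1..n}" "i \<noteq> j" "i \<noteq> k" "j \<noteq> k"
  shows "D.expectation (\<lambda>x. h0 (x i) (x j) * h0 (x i) (x k)) = var1"
proof -
  define F where "F p = h0 (fst p) (fst (snd p)) * h0 (fst p) (snd (snd p))" for p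
  interpret p3: pair_prob_space \<mu> "\<mu> \<Otimes>\<^sub>M \<mu>" ..
  have m: "(\<lambda>x. (x i, x j, x k)) \<in> measurable D (\<mu> \<Otimes>\<^sub>M (\<mu> \<Otimes>\<^sub>M \<mu>))" using assms by measurable
  have Fm [measurable]: "F \<in> borel_measurable (\<mu> \<Otimes>\<^sub>M (\<mu> \<Otimes>\<^sub>M \<mu>))" unfolding F_def by measurable
  have int: "integrable (\<mu> \<Otimes>\<^sub>M (\<mu> \<Otimes>\<^sub>M \<mu>)) F"
    using integrable_distr_eq[OF m Fm] h0_mult_integrable[of i j i k] assms
    unfolding distr_coord3[OF assms] by (simp add: F_def)
  have "D.expectation (\<lambda>x. h0 (x i) (x j) * h0 (x i) (x k)) = D.expectation (\<lambda>x. F (x i, x j, x k))"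
    by (simp add: F_def)
  also have "\<dots> = (\<integral>p. F p \<partial>(\<mu> \<Otimes>\<^sub>M (\<mu> \<Otimes>\<^sub>M \<mu>)))"
    using integral_distr[OF m Fm] unfolding distr_coord3[OF assms] by simp
  also have "\<dots> = (\<integral>x. (\<integral>q. F (x, q) \<partial>(\<mu> \<Otimes>\<^sub>M \<mu>)) \<partial>\<mu>)"
    using p3.integral_fst'[OF int] by simp
  also have "\<dots> = var1"
    unfolding var1_def
  proof (rule integral_cong_AE)
    \<comment> \<open>The inner Fubini step, which splits the integral into a product, needs an
      integrable section.\<close>
    have "AE x in \<mu>. integrable (\<mu> \<Otimes>\<^sub>M \<mu>) (\<lambda>q. F (x, q))"
      by (rule p3.AE_integrable_fst'[OF int])
    then show "AE x in \<mu>. (\<integral>q. F (x, q) \<partial>(\<mu> \<Otimes>\<^sub>M \<mu>)) = (h1 x)\<^sup>2"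
    proof (rule AE_mp, intro AE_I2 impI)
      fix x assume "integrable (\<mu> \<Otimes>\<^sub>M \<mu>) (\<lambda>q. F (x, q))"
      from pp.integral_fst'[OF this]
      show "(\<integral>q. F (x, q) \<partial>(\<mu> \<Otimes>\<^sub>M \<mu>)) = (h1 x)\<^sup>2"
        by (simp add: F_def h1_def power2_eq_square)
    qed
  qed (auto simp: h1_def)
  finally show ?thesis .
qed

lemma cov_none:
  assumes "i \<in> {1..n}" "j \<in> {1..n}" "i \<noteq> j" "k \<in> {1..n}" "l \<in> {1..n}" "k \<noteq> l"
    and "{i, j} \<inter> {k, l} = {}"
  shows "D.expectation (\<lambda>x. h0 (x i) (x j) * h0 (x k) (x l)) = 0"
proof -
  have "D.indep_var borel (\<lambda>x. h0 (x i) (x j)) borel (\<lambda>x. h0 (x k) (x l))"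
    using assms by (intro indep_var_coords[of "{i, j}" "{k, l}"]) auto
  then show ?thesis using h0_D assms by (simp add: D.indep_var_lebesgue_integral)
qed

lemma var1_nonneg: "0 \<le> var1" unfolding var1_def by simp

text \<open>By \<open>cov_one\<close>, \<open>var1\<close> is the mean of a product of two kernels
  that share an index; a b \<le> (a^2 + b^2) / 2 bounds it by the common second moment.\<close>

lemma var1_le_var: "var1 \<le> var"
proof -
  have i: "1 \<in> {1..n}" "2 \<in> {1..n}" "3 \<in> {1..n}" using n3 by auto
  have "D.expectation (\<lambda>x. h0 (x 1) (x 2) * h0 (x 1) (x 3))
      \<le> D.expectation (\<lambda>x. ((h0 (x 1) (x 2))\<^sup>2 + (h0 (x 1) (x 3))\<^sup>2) / 2)"
  proof (rule integral_mono)
    have "a * b \<le> (a\<^sup>2 + b\<^sup>2) / 2" for a b :: real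
      using sum_squares_bound[of a b] by (simp add: field_simps)
    then show "h0 (x 1) (x 2) * h0 (x 1) (x 3) \<le> ((h0 (x 1) (x 2))\<^sup>2 + (h0 (x 1) (x 3))\<^sup>2) / 2" for x .
  qed (use h0_mult_integrable h0_sq_D i in auto)
  then show ?thesis using cov_one[OF i] h0_sq_D i by simp
qed

lemma h0_sym: "x \<in> space D \<Longrightarrow> i \<in> {1..n} \<Longrightarrow> j \<in> {1..n} \<Longrightarrow> h0 (x i) (x j) = h0 (x j) (x i)"
  using h_sym by (simp add: h0_def space_D)

definition cov :: "nat \<times> nat \<Rightarrow> nat \<times> nat \<Rightarrow> real" where
  "cov e e' = D.expectation (\<lambda>x. h0 (x (fst e)) (x (snd e)) * h0 (x (fst e')) (x (snd e')))"

definition adj :: "nat \<times> nat \<Rightarrow> (nat \<times> nat) set" where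
  "adj e = {e' \<in> index_pairs n. e' \<noteq> e \<and> {fst e, snd e} \<inter> {fst e', snd e'} \<noteq> {}}"

text \<open>A different pair that meets \<open>e\<close> is given by the shared endpoint (2 choices)
  and an index outside \<open>e\<close> (n - 2 choices); \<open>min\<close> and \<open>max\<close>
  restore the increasing order.\<close>

lemma card_adj_le:
  assumes "e \<in> index_pairs n"
  shows "card (adj e) \<le> 2 * (n - 2)"
proof -
  obtain i j where e: "e = (i, j)" by fastforce
  have ij: "1 \<le> i" "i < j" "j \<le> n" using assms by (auto simp: e index_pairs_def)
  have "adj e \<subseteq> (\<lambda>(c, k). (min c k, max c k)) ` ({i, j} \<times> ({1..n} - {i, j}))"
  proof
    fix e' assume "e' \<in> adj e"
    then obtain a b where e': "e' = (a, b)" "1 \<le> a" "a < b" "b \<le> n" "(a, b) \<noteq> (i, j)"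
      "a \<in> {i, j} \<or> b \<in> {i, j}"
      by (cases e') (auto simp: adj_def e index_pairs_def)
    show "e' \<in> (\<lambda>(c, k). (min c k, max c k)) ` ({i, j} \<times> ({1..n} - {i, j}))"
    proof (cases "a \<in> {i, j}")
      case True
      then show ?thesis using e' ij by (intro image_eqI[where x = "(a, b)"]) auto
    next
      case False
      then show ?thesis using e' ij by (intro image_eqI[where x = "(b, a)"]) auto
    qed
  qed
  then have "card (adj e) \<le> card ((\<lambda>(c, k). (min c k, max c k)) ` ({i, j} \<times> ({1..n} - {i, j})))"
    by (intro card_mono) auto
  also have "\<dots> \<le> card ({i, j} \<times> ({1..n} - {i, j}))" by (intro card_image_le) auto
  also have "\<dots> = 2 * (n - 2)" using ij by (simp add: card_cartesian_product card_Diff_subset)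
  finally show ?thesis .
qed

lemma cov_self: "e \<in> index_pairs n \<Longrightarrow> cov e e = var"
  using h0_sq_D(2)[of "fst e" "snd e"] by (auto simp: cov_def index_pairs_def power2_eq_square)

text \<open>\<open>cov_one\<close> expects the shared index in first place on both sides. The
  symmetry of the kernel moves it there in each of the four possible positions.\<close>

lemma cov_adj:
  assumes e: "e \<in> index_pairs n" and "e' \<in> adj e"
  shows "cov e e' = var1"
proof -
  have swap: "D.expectation (\<lambda>x. h0 (x i) (x j) * h0 (x k) (x l))
      = D.expectation (\<lambda>x. h0 (x a) (x b) * h0 (x c) (x d))"
    if "(a, b) = (i, j) \<or> (a, b) = (j, i)" "(c, d) = (k, l) \<or> (c, d) = (l, k)"
      "i \<in> {1..n}" "j \<in> {1..n}" "k \<in> {1..n}" "l \<in> {1..n}" for a b c d i j k l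
    using that h0_sym by (intro Bochner_Integration.integral_cong) auto
  obtain i j k l where "e = (i, j)" "e' = (k, l)" by fastforce
  with assms have *: "i \<in> {1..n}" "j \<in> {1..n}" "k \<in> {1..n}" "l \<in> {1..n}" "i < j" "k < l"
    "(i, j) \<noteq> (k, l)" "k = i \<or> k = j \<or> l = i \<or> l = j"
    and ee: "e = (i, j)" "e' = (k, l)"
    by (auto simp: adj_def index_pairs_def)
  from *(8) show ?thesis
  proof (elim disjE)
    assume "k = i" then show ?thesis
      using * cov_one[of i j l] by (auto simp: cov_def ee)
  next
    assume "k = j" then show ?thesis
      using * cov_one[of j i l] swap[of j i i j j l k l] by (auto simp: cov_def ee)
  next
    assume "l = i" then show ?thesis
      using * cov_one[of i j k] swap[of i j i j i k k l] by (auto simp: cov_def ee)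
  next
    assume "l = j" then show ?thesis
      using * cov_one[of j i k] swap[of j i i j j k k l] by (auto simp: cov_def ee)
  qed
qed

lemma cov_nonadj:
  assumes "e \<in> index_pairs n" "e' \<in> index_pairs n" "e' \<noteq> e" "e' \<notin> adj e"
  shows "cov e e' = 0"
  using assms unfolding cov_def
  by (intro cov_none) (auto simp: adj_def index_pairs_def)

lemma sum_cov_le:
  assumes "e \<in> index_pairs n"
  shows "(\<Sum>e'\<in>index_pairs n - {e}. cov e e') \<le> 2 * (real n - 2) * var1"
proof -
  have "(\<Sum>e'\<in>index_pairs n - {e}. cov e e') = (\<Sum>e'\<in>adj e. cov e e')"
  proof (rule sum.mono_neutral_right)
    show "\<forall>e'\<in>index_pairs n - {e} - adj e. cov e e' = 0" using cov_nonadj[OF assms] by auto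
  qed (auto simp: adj_def)
  also have "\<dots> = card (adj e) * var1" using assms by (simp add: cov_adj)
  also have "\<dots> \<le> (2 * (n - 2)) * var1"
    using card_adj_le[OF assms] var1_nonneg by (intro mult_right_mono) (simp_all only: of_nat_le_iff)
  finally show ?thesis using n3 by (simp add: of_nat_diff)
qed

end

subsection \<open>Variance of the mean over a random block\<close>

text \<open>An injection of \<open>V\<close> into \<open>W\<close> is completed by a bijection of
  the complements. It will move the sample points of a block into a prescribed window of
  indices.\<close>

lemma ex_permutes_image_subset:
  assumes "finite S" "V \<subseteq> S" "W \<subseteq> S" "card V \<le> card W"
  shows "\<exists>\<pi>. \<pi> permutes S \<and> \<pi> ` V \<subseteq> W"
proof -
  obtain W' where W': "W' \<subseteq> W" "card W' = card V"
    using assms(4) by (metis obtain_subset_with_card_n)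
  have fin: "finite V" "finite W'" using assms W' by (auto dest: finite_subset)
  obtain f where f: "bij_betw f V W'"
    using finite_same_card_bij[OF fin] W' by auto
  have "card (S - V) = card (S - W')"
    using assms W' fin by (simp add: card_Diff_subset)
  then obtain f' where f': "bij_betw f' (S - V) (S - W')"
    using finite_same_card_bij[of "S - V" "S - W'"] assms by auto
  define \<pi> where "\<pi> x = (if x \<in> V then f x else if x \<in> S then f' x else x)" for x
  have "bij_betw \<pi> V W'" using f by (rule bij_betw_cong[THEN iffD1, rotated]) (simp add: \<pi>_def)
  moreover have "bij_betw \<pi> (S - V) (S - W')"
    using f' by (rule bij_betw_cong[THEN iffD1, rotated]) (simp add: \<pi>_def)
  ultimately have "bij_betw \<pi> (V \<union> (S - V)) (W' \<union> (S - W'))" by (rule bij_betw_combine) auto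
  moreover have "V \<union> (S - V) = S" "W' \<union> (S - W') = S" using assms W' by auto
  ultimately have "bij_betw \<pi> S S" by simp
  then have "\<pi> permutes S" using assms(2) by (intro bij_imp_permutes) (auto simp: \<pi>_def)
  moreover have "\<pi> ` V \<subseteq> W" using f W' by (auto simp: \<pi>_def bij_betw_def)
  ultimately show ?thesis by blast
qed

text \<open>The action of a permutation on unordered pairs, which are represented by increasing
  ones. Sorting a reversed pair again is harmless for a symmetric kernel.\<close>

definition sorted_pair :: "(nat \<Rightarrow> nat) \<Rightarrow> nat \<times> nat \<Rightarrow> nat \<times> nat" where
  "sorted_pair \<pi> = (\<lambda>(i, j). (min (\<pi> i) (\<pi> j), max (\<pi> i) (\<pi> j)))"

lemma bij_sorted_pair:
  assumes \<pi>: "\<pi> permutes {1..n}"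
  shows "bij_betw (sorted_pair \<pi>) (index_pairs n) (index_pairs n)"
proof -
  have inj: "\<pi> i = \<pi> j \<longleftrightarrow> i = j" for i j using permutes_inj[OF \<pi>] by (auto simp: inj_def)
  have ran: "1 \<le> \<pi> i \<and> \<pi> i \<le> n" if "1 \<le> i" "i \<le> n" for i
    using permutes_in_image[OF \<pi>, of i] that by simp
  have sub: "sorted_pair \<pi> ` index_pairs n \<subseteq> index_pairs n"
  proof (rule image_subsetI)
    fix e assume "e \<in> index_pairs n"
    then obtain i j where e: "e = (i, j)" "1 \<le> i" "i < j" "j \<le> n" by (auto simp: index_pairs_def)
    have "\<pi> i \<noteq> \<pi> j" using e inj by simp
    then show "sorted_pair \<pi> e \<in> index_pairs n"
      using ran[of i] ran[of j] e by (auto simp: sorted_pair_def index_pairs_def min_def max_def)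
  qed
  have "inj_on (sorted_pair \<pi>) (index_pairs n)"
  proof (rule inj_onI)
    fix e e' assume "e \<in> index_pairs n" "e' \<in> index_pairs n" and eq: "sorted_pair \<pi> e = sorted_pair \<pi> e'"
    then obtain i j k l where e: "e = (i, j)" "e' = (k, l)" "i < j" "k < l"
      by (auto simp: index_pairs_def)
    from eq have "\<pi> i = \<pi> k \<and> \<pi> j = \<pi> l \<or> \<pi> i = \<pi> l \<and> \<pi> j = \<pi> k"
      by (auto simp: e sorted_pair_def min_def max_def split: if_splits)
    then show "e = e'" using e inj by auto
  qed
  then show ?thesis using sub endo_inj_surj[of "index_pairs n" "sorted_pair \<pi>"]
    by (auto simp: bij_betw_def)
qed

context kernel_sample
begin

lemma pair_mean_measurable:
  assumes "\<And>m. m \<in> {1..M} \<Longrightarrow> fst (b m) \<in> A \<and> snd (b m) \<in> A"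
  shows "pair_mean M h b \<in> borel_measurable (PiM A (\<lambda>_. \<mu>))"
  unfolding pair_mean_def[abs_def] using assms
  by (intro borel_measurable_divide borel_measurable_sum h_measurable measurable_component_singleton) auto

lemma inj_maps_index:
  assumes "b \<in> inj_maps {1..M} (index_pairs n)" "m \<in> {1..M}"
  shows "fst (b m) \<in> {1..n}" "snd (b m) \<in> {1..n}" "fst (b m) < snd (b m)"
  using inj_maps_in[OF assms] by (auto simp: index_pairs_def)

lemma pair_mean_borel_D:
  assumes "b \<in> inj_maps {1..M} (index_pairs n)"
  shows "pair_mean M h b \<in> borel_measurable D"
  unfolding D_def by (rule pair_mean_measurable) (use inj_maps_index[OF assms] in auto)

lemma pair_mean_square:
  assumes "b \<in> inj_maps {1..M} (index_pairs n)" "0 < M"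
  shows "integrable D (\<lambda>x. (pair_mean M h b x - mean)\<^sup>2)"
    and "D.expectation (\<lambda>x. (pair_mean M h b x - mean)\<^sup>2)
      = (\<Sum>m=1..M. \<Sum>m'=1..M. cov (b m) (b m')) / (real M)\<^sup>2"
proof -
  let ?h = "\<lambda>m x. h0 (x (fst (b m))) (x (snd (b m)))"
  have eq: "(pair_mean M h b x - mean)\<^sup>2 = (\<Sum>m=1..M. \<Sum>m'=1..M. ?h m x * ?h m' x) / (real M)\<^sup>2" for x
  proof -
    have "pair_mean M h b x - mean = (\<Sum>m=1..M. ?h m x) / M"
      using \<open>0 < M\<close> by (simp add: pair_mean_def h0_def sum_subtractf diff_divide_distrib)
    then show ?thesis
      by (simp add: power_divide) (simp add: power2_eq_square sum_product)
  qed
  have int: "integrable D (\<lambda>x. ?h m x * ?h m' x)" if "m \<in> {1..M}" "m' \<in> {1..M}" for m m'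
    using inj_maps_index[OF assms(1) that(1)] inj_maps_index[OF assms(1) that(2)]
    by (intro h0_mult_integrable) auto
  have int2: "integrable D (\<lambda>x. \<Sum>m'=1..M. ?h m x * ?h m' x)" if "m \<in> {1..M}" for m
    by (intro Bochner_Integration.integrable_sum int that)
  have exp2: "D.expectation (\<lambda>x. \<Sum>m'=1..M. ?h m x * ?h m' x) = (\<Sum>m'=1..M. cov (b m) (b m'))"
    if "m \<in> {1..M}" for m
    unfolding cov_def by (intro Bochner_Integration.integral_sum int that)
  have "integrable D (\<lambda>x. \<Sum>m=1..M. \<Sum>m'=1..M. ?h m x * ?h m' x)"
    by (intro Bochner_Integration.integrable_sum[OF int2])
  moreover have "D.expectation (\<lambda>x. \<Sum>m=1..M. \<Sum>m'=1..M. ?h m x * ?h m' x)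
      = (\<Sum>m=1..M. D.expectation (\<lambda>x. \<Sum>m'=1..M. ?h m x * ?h m' x))"
    by (rule Bochner_Integration.integral_sum[OF int2])
  moreover have "\<dots> = (\<Sum>m=1..M. \<Sum>m'=1..M. cov (b m) (b m'))"
    by (rule sum.cong[OF refl exp2])
  ultimately show "integrable D (\<lambda>x. (pair_mean M h b x - mean)\<^sup>2)"
    "D.expectation (\<lambda>x. (pair_mean M h b x - mean)\<^sup>2)
      = (\<Sum>m=1..M. \<Sum>m'=1..M. cov (b m) (b m')) / (real M)\<^sup>2"
    unfolding eq by simp_all
qed

text \<open>Two draws are a uniform pair of distinct elements of the N = n (n - 1) / 2 index pairs.
  As N - 1 = (n - 2) (n + 1) / 2, at most 2 (n - 2) neighbours of covariance \<open>var1\<close>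
  average to 4 \<open>var1\<close> / (n + 1).\<close>

lemma sum_pair_mean_square_le:
  assumes "0 < M"
  defines "B \<equiv> inj_maps {1..M} (index_pairs n)"
  shows "(\<Sum>b\<in>B. D.expectation (\<lambda>x. (pair_mean M h b x - mean)\<^sup>2))
    \<le> card B * (var / M + 4 * var1 / (real n + 1))"
proof -
  define N where "N = real (card (index_pairs n))"
  have N: "N = real n * (real n - 1) / 2"
    using arg_cong[OF card_index_pairs[of n], of real] n3 by (simp add: N_def of_nat_diff)
  then have N1: "N - 1 = (real n - 2) * (real n + 1) / 2" by (simp add: algebra_simps)
  have "N - 1 > 0" unfolding N1 using n3 by (intro divide_pos_pos mult_pos_pos) auto
  have diag: "(\<Sum>b\<in>B. cov (b m) (b m)) = card B * var" if "m \<in> {1..M}" for m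
    using that by (simp add: B_def inj_maps_in cov_self)
  have off: "(\<Sum>b\<in>B. cov (b m) (b m')) \<le> card B * (4 * var1 / (real n + 1))"
    if "m \<in> {1..M}" "m' \<in> {1..M}" "m \<noteq> m'" for m m'
  proof -
    have "(N * (N - 1)) * (\<Sum>b\<in>B. cov (b m) (b m'))
        = card B * (\<Sum>e\<in>index_pairs n. \<Sum>e'\<in>index_pairs n - {e}. cov e e')"
      unfolding N_def B_def using that by (intro sum_inj_maps_two) auto
    also have "\<dots> \<le> card B * (\<Sum>e\<in>index_pairs n. 2 * (real n - 2) * var1)"
      by (intro mult_left_mono sum_mono sum_cov_le) auto
    also have "\<dots> = N * (N - 1) * (card B * (4 * var1 / (real n + 1)))"
      unfolding N1 by (simp add: N_def[symmetric] field_simps)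
    finally show ?thesis
      using \<open>N - 1 > 0\<close> mult_le_cancel_left_pos[of "N * (N - 1)"] by (simp only: mult_pos_pos)
  qed
  have "(\<Sum>b\<in>B. D.expectation (\<lambda>x. (pair_mean M h b x - mean)\<^sup>2))
      = (\<Sum>b\<in>B. \<Sum>m=1..M. \<Sum>m'=1..M. cov (b m) (b m')) / (real M)\<^sup>2"
    using assms by (simp add: pair_mean_square sum_divide_distrib)
  also have "(\<Sum>b\<in>B. \<Sum>m=1..M. \<Sum>m'=1..M. cov (b m) (b m'))
      = (\<Sum>m=1..M. \<Sum>m'=1..M. \<Sum>b\<in>B. cov (b m) (b m'))"
    by (subst sum.swap, intro sum.cong refl, subst sum.swap) simp
  \<comment> \<open>The off-diagonal bound is also added on the diagonal, which replaces M (M - 1)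
    by M^2.\<close>
  also have "\<dots> \<le> (\<Sum>m=1..M. \<Sum>m'=1..M.
      (if m' = m then card B * var else 0) + card B * (4 * var1 / (real n + 1)))"
    using diag off var1_nonneg by (intro sum_mono) auto
  also have "\<dots> = card B * (M * var + (real M)\<^sup>2 * (4 * var1 / (real n + 1)))"
    by (simp add: sum.distrib algebra_simps power2_eq_square)
  also have "\<dots> / (real M)\<^sup>2 = card B * (var / M + 4 * var1 / (real n + 1))"
  proof -
    have "c * (m * v + m\<^sup>2 * w) / m\<^sup>2 = c * (v / m + w)" if "m \<noteq> 0" for c m v w :: real
      using that by (simp add: field_simps power2_eq_square)
    from this[of "real M"] show ?thesis using \<open>0 < M\<close> by (simp only: of_nat_eq_0_iff)
  qed
  finally show ?thesis by (simp add: divide_right_mono)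
qed

definition far :: "nat \<Rightarrow> real \<Rightarrow> (nat \<Rightarrow> nat \<times> nat) \<Rightarrow> (nat \<Rightarrow> 'z) \<Rightarrow> real" where
  "far M t b x = (if t < \<bar>pair_mean M h b x - mean\<bar> then 1 else 0)"

lemma far_unit: "far M t b x \<in> {0..1}" by (simp add: far_def)

lemma far_measurable:
  assumes "\<And>m. m \<in> {1..M} \<Longrightarrow> fst (b m) \<in> A \<and> snd (b m) \<in> A"
  shows "far M t b \<in> borel_measurable (PiM A (\<lambda>_. \<mu>))"
proof -
  have [measurable]: "pair_mean M h b \<in> borel_measurable (PiM A (\<lambda>_. \<mu>))"
    using assms by (rule pair_mean_measurable)
  show ?thesis unfolding far_def[abs_def] by measurable
qed

lemma far_borel_D:
  assumes "b \<in> inj_maps {1..M} (index_pairs n)"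
  shows "far M t b \<in> borel_measurable D"
  unfolding D_def by (rule far_measurable) (use inj_maps_index[OF assms] in auto)

text \<open>Chebyshev's inequality averaged over all blocks. Single blocks may have a larger
  variance than the average, so no bound for an individual \<open>b\<close> is claimed.\<close>

lemma sum_far_le:
  fixes q :: real
  assumes "0 < M" "0 \<le> t" "0 \<le> q" and q: "var / M + 4 * var1 / (real n + 1) \<le> q * t\<^sup>2"
  defines "B \<equiv> inj_maps {1..M} (index_pairs n)"
  shows "(\<Sum>b\<in>B. D.expectation (far M t b)) \<le> card B * q"
proof -
  let ?V = "\<lambda>b. D.expectation (\<lambda>x. (pair_mean M h b x - mean)\<^sup>2)"
  have le: "(\<Sum>b\<in>B. ?V b) \<le> card B * (q * t\<^sup>2)"
    using sum_pair_mean_square_le[OF \<open>0 < M\<close>] mult_left_mono[OF q, of "card B"] by (simp add: B_def)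
  have fB: "finite B" by (simp add: B_def)
  have m [measurable]: "pair_mean M h b \<in> borel_measurable D" "far M t b \<in> borel_measurable D" if "b \<in> B" for b
    using that far_borel_D pair_mean_borel_D by (auto simp: B_def)
  show ?thesis
  proof (cases "t = 0")
    \<comment> \<open>Division by t^2 is impossible here. The hypothesis then forces all the second
      moments to vanish, so each block mean equals \<open>mean\<close> almost surely.\<close>
    case True
    have V0: "?V b = 0" if "b \<in> B" for b
    proof (rule antisym)
      have "?V b \<le> (\<Sum>b\<in>B. ?V b)" using fB that by (intro member_le_sum) auto
      then show "?V b \<le> 0" using le True by simp
    qed simp
    have "D.expectation (far M t b) = 0" if b: "b \<in> B" for b
    proof -
      have "AE x in D. (pair_mean M h b x - mean)\<^sup>2 = 0"
        using V0[OF b] pair_mean_square(1)[of b M] b \<open>0 < M\<close>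
        by (subst integral_nonneg_eq_0_iff_AE[symmetric]) (auto simp: B_def)
      then have "AE x in D. far M t b x = 0"
        by eventually_elim (simp add: far_def True)
      then have "D.expectation (far M t b) = D.expectation (\<lambda>_. 0)"
        using b by (intro integral_cong_AE) auto
      then show ?thesis by simp
    qed
    then show ?thesis using \<open>0 \<le> q\<close> by simp
  next
    case False
    then have t: "t > 0" using \<open>0 \<le> t\<close> by simp
    have "t\<^sup>2 * D.expectation (far M t b) \<le> ?V b" if b: "b \<in> B" for b
    proof -
      have "t\<^sup>2 * far M t b x \<le> (pair_mean M h b x - mean)\<^sup>2" for x
        using t power_mono[of t "\<bar>pair_mean M h b x - mean\<bar>" 2] by (auto simp: far_def)
      moreover have "integrable D (far M t b)"
        using b far_unit by (intro D.integrable_const_bound[where B = 1]) auto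
      ultimately have "D.expectation (\<lambda>x. t\<^sup>2 * far M t b x) \<le> ?V b"
        using b pair_mean_square(1)[of b M] \<open>0 < M\<close> by (intro integral_mono) (auto simp: B_def)
      then show ?thesis by simp
    qed
    then have "t\<^sup>2 * (\<Sum>b\<in>B. D.expectation (far M t b)) \<le> (\<Sum>b\<in>B. ?V b)"
      unfolding sum_distrib_left by (intro sum_mono)
    also have "\<dots> \<le> t\<^sup>2 * (card B * q)" using le by (simp add: mult_ac)
    finally show ?thesis using t by (simp add: mult_le_cancel_left_pos)
  qed
qed

end

subsection \<open>Concentration of the fraction of far blocks\<close>

context kernel_sample
begin

definition permuted :: "(nat \<Rightarrow> nat) \<Rightarrow> (nat \<Rightarrow> 'z) \<Rightarrow> nat \<Rightarrow> 'z" where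
  "permuted \<pi> x = (\<lambda>i\<in>{1..n}. x (\<pi> i))"

lemma permuted_distr: "\<pi> permutes {1..n} \<Longrightarrow> distr D D (permuted \<pi>) = D"
  unfolding permuted_def[abs_def]
  by (intro distr_D_reindex permutes_inj_on[of _ "{1..n}"]) (auto dest: permutes_in_image)

lemma permuted_measurable:
  assumes "\<pi> permutes {1..n}"
  shows "permuted \<pi> \<in> measurable D D"
  unfolding permuted_def[abs_def] D_def
  using permutes_in_image[OF assms] by (intro measurable_restrict measurable_component_singleton) auto

lemma permuted_permuted:
  assumes "\<rho> permutes {1..n}"
  shows "permuted \<rho> (permuted \<pi> x) = permuted (\<pi> \<circ> \<rho>) x"
  using permutes_in_image[OF assms] by (auto simp: permuted_def fun_eq_iff)

lemma pair_mean_permuted: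
  assumes "b \<in> inj_maps {1..M} (index_pairs n)"
  shows "pair_mean M h b (permuted \<pi> x) = pair_mean M h (\<lambda>m. map_prod \<pi> \<pi> (b m)) x"
  using inj_maps_index[OF assms] unfolding pair_mean_def by (simp add: permuted_def)

lemma far_permuted:
  assumes "b \<in> inj_maps {1..M} (index_pairs n)"
  shows "far M t b (permuted \<pi> x) = far M t (\<lambda>m. map_prod \<pi> \<pi> (b m)) x"
  using pair_mean_permuted[OF assms] by (simp add: far_def)

definition far_mean :: "nat \<Rightarrow> real \<Rightarrow> (nat \<Rightarrow> 'z) \<Rightarrow> real" where
  "far_mean M t x = inj_mean {1..M} (index_pairs n) (\<lambda>b. far M t b x)"

lemma far_mean_unit: "far_mean M t x \<in> {0..1}"
  unfolding far_mean_def using far_unit by (rule inj_mean_unit)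

lemma far_mean_borel [measurable]: "far_mean M t \<in> borel_measurable D"
  unfolding far_mean_def[abs_def] inj_mean_def
  by (intro borel_measurable_divide borel_measurable_sum far_borel_D) auto

text \<open>Permuting the sample turns the block \<open>b\<close> into the block of the permuted
  pairs, a bijection of all blocks, so the average over them is unchanged.\<close>

lemma far_mean_permuted:
  assumes \<pi>: "\<pi> permutes {1..n}" and x: "x \<in> space D"
  shows "far_mean M t (permuted \<pi> x) = far_mean M t x"
proof -
  have "far M t b (permuted \<pi> x) = far M t (\<lambda>m\<in>{1..M}. sorted_pair \<pi> (b m)) x"
    if b: "b \<in> inj_maps {1..M} (index_pairs n)" for b
  proof -
    have "h (x (\<pi> (fst (b m)))) (x (\<pi> (snd (b m))))
        = h (x (fst (sorted_pair \<pi> (b m)))) (x (snd (sorted_pair \<pi> (b m))))" if "m \<in> {1..M}" for m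
    proof -
      have "\<pi> (fst (b m)) \<in> {1..n}" "\<pi> (snd (b m)) \<in> {1..n}"
        using inj_maps_index[OF b that] permutes_in_image[OF \<pi>] by auto
      then have "x (\<pi> (fst (b m))) \<in> space \<mu>" "x (\<pi> (snd (b m))) \<in> space \<mu>"
        using x space_D by auto
      then show ?thesis
        using h_sym by (auto simp: sorted_pair_def min_def max_def case_prod_unfold)
    qed
    then have "pair_mean M h (\<lambda>m. map_prod \<pi> \<pi> (b m)) x
        = pair_mean M h (\<lambda>m\<in>{1..M}. sorted_pair \<pi> (b m)) x"
      unfolding pair_mean_def by (intro arg_cong2[of _ _ _ _ "(/)"] sum.cong) simp_all
    then show ?thesis
      unfolding far_permuted[OF b] by (simp add: far_def)
  qed
  then have "(\<Sum>b\<in>inj_maps {1..M} (index_pairs n). far M t b (permuted \<pi> x))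
      = (\<Sum>b\<in>inj_maps {1..M} (index_pairs n). far M t (\<lambda>m\<in>{1..M}. sorted_pair \<pi> (b m)) x)"
    by simp
  also have "\<dots> = (\<Sum>b\<in>inj_maps {1..M} (index_pairs n). far M t b x)"
    by (rule inj_maps_relabel[OF bij_sorted_pair[OF \<pi>]])
  finally show ?thesis by (simp add: far_mean_def inj_mean_def)
qed

lemma pair_mean_restrict:
  assumes "\<And>m. m \<in> {1..M} \<Longrightarrow> fst (b m) \<in> A \<and> snd (b m) \<in> A"
  shows "pair_mean M h b (restrict x A) = pair_mean M h b x"
  using assms unfolding pair_mean_def by simp

text \<open>
  Hoeffding's device for U-statistics: as the far fraction is invariant under permutations of the
  sample, it is an average over permutations of the mean of \<open>r\<close> independent copies of a statistic
  of \<open>2 * M\<close> sample points, and convexity of the exponential function moves the average outside.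
\<close>

lemma far_mean_mgf:
  fixes l t :: real
  assumes M: "0 < M" and r: "0 < r" "2 * M * r \<le> n" and "0 < l"
  defines "B \<equiv> inj_maps {1..M} (index_pairs n)"
  defines "p \<equiv> (\<Sum>b\<in>B. D.expectation (far M t b)) / card B"
  shows "D.expectation (\<lambda>x. exp (l * far_mean M t x)) \<le> exp (l * p + l\<^sup>2 / (8 * real r))"
proof -
  have fB: "finite B" by (simp add: B_def)
  have "2 * M \<le> n" using r by (metis One_nat_def Suc_leI dual_order.trans mult.right_neutral mult_le_mono2)
  define V where "V b = (\<Union>m\<in>{1..M}. {fst (b m), snd (b m)})" for b :: "nat \<Rightarrow> nat \<times> nat"
  \<comment> \<open>Disjoint windows of 2 M indices, each with room for all sample points of one
    block; \<open>r\<close> of them fit into \<open>{1..n}\<close>.\<close>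
  define L where "L k = {2 * M * k + 1..2 * M * (k + 1)}" for k
  have L: "L k \<subseteq> {1..n}" if "k < r" for k
  proof -
    have "2 * M * (k + 1) \<le> 2 * M * r" using that by (intro mult_le_mono2) simp
    then show ?thesis using r by (auto simp: L_def)
  qed
  have disj: "disjoint_family_on L {..<r}"
    unfolding disjoint_family_on_def
  proof (intro ballI impI)
    have "L k \<inter> L k' = {}" if "k < k'" for k k'
    proof -
      have "2 * M * (k + 1) \<le> 2 * M * k'" using that by (intro mult_le_mono2) simp
      then show ?thesis by (auto simp: L_def)
    qed
    then show "L k \<inter> L k' = {}" if "k \<noteq> k'" for k k' using that by (metis Int_commute neqE)
  qed
  have "\<exists>\<pi>. \<pi> permutes {1..n} \<and> \<pi> ` V b \<subseteq> L k" if b: "b \<in> B" and k: "k < r" for b k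
  proof (rule ex_permutes_image_subset)
    show "V b \<subseteq> {1..n}" using inj_maps_index[of b M] b by (force simp: V_def B_def)
    have "card (V b) \<le> (\<Sum>m\<in>{1..M}. card {fst (b m), snd (b m)})"
      unfolding V_def by (rule card_UN_le) simp
    also have "\<dots> \<le> (\<Sum>m\<in>{1..M}. 2)" by (intro sum_mono) (simp add: card_insert_if)
    also have "\<dots> = card (L k)" by (simp add: L_def algebra_simps)
    finally show "card (V b) \<le> card (L k)" .
  qed (use L[OF k] in auto)
  then obtain \<rho> where \<rho>: "\<And>b k. b \<in> B \<Longrightarrow> k < r \<Longrightarrow> \<rho> b k permutes {1..n} \<and> \<rho> b k ` V b \<subseteq> L k"
    by metis
  have \<rho>_in: "fst (map_prod (\<rho> b k) (\<rho> b k) (b m)) \<in> L k \<and> snd (map_prod (\<rho> b k) (\<rho> b k) (b m)) \<in> L k"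
    if "b \<in> B" "k < r" "m \<in> {1..M}" for b k m
    using \<rho>[OF that(1,2)] that(3) by (force simp: V_def)
  \<comment> \<open>Each block is moved into window \<open>k\<close> before averaging.
    \<open>F k\<close> reads only the points of that window, so the \<open>F k\<close> are
    independent, and permutation invariance of \<open>D\<close> gives each of them the mean
    \<open>p\<close>.\<close>
  define F where "F k x = (\<Sum>b\<in>B. far M t (\<lambda>m. map_prod (\<rho> b k) (\<rho> b k) (b m)) x) / card B" for k x
  have F_eq: "F k x = (\<Sum>b\<in>B. far M t b (permuted (\<rho> b k) x)) / card B" for k x
    by (simp add: F_def far_permuted B_def)
  have F_unit: "F k x \<in> {0..1}" for k x
  proof -
    have "0 \<le> (\<Sum>b\<in>B. far M t b (permuted (\<rho> b k) x))" using far_unit by (intro sum_nonneg) auto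
    moreover have "(\<Sum>b\<in>B. far M t b (permuted (\<rho> b k) x)) \<le> (\<Sum>b\<in>B. 1)"
      using far_unit by (intro sum_mono) auto
    ultimately show ?thesis by (auto simp: F_eq divide_le_eq_1 card_gt_0_iff)
  qed
  have F_meas: "F k \<in> borel_measurable (PiM (L k) (\<lambda>_. \<mu>))" if "k < r" for k
    unfolding F_def[abs_def] using \<rho>_in that
    by (intro borel_measurable_divide borel_measurable_sum far_measurable) auto
  have F_restrict: "F k (restrict x (L k)) = F k x" if "k < r" for k x
  proof -
    have "far M t (\<lambda>m. map_prod (\<rho> b k) (\<rho> b k) (b m)) (restrict x (L k))
        = far M t (\<lambda>m. map_prod (\<rho> b k) (\<rho> b k) (b m)) x" if b: "b \<in> B" for b
      unfolding far_def by (subst pair_mean_restrict[OF \<rho>_in[OF b \<open>k < r\<close>]]) simp_all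
    then show ?thesis by (simp add: F_def)
  qed
  have F_indep: "D.indep_vars (\<lambda>_. borel) F {..<r}"
  proof -
    have "D.indep_vars (\<lambda>k. PiM (L k) (\<lambda>_. \<mu>)) (\<lambda>k x. restrict (\<lambda>i. x i) (L k)) {..<r}"
      using L disj by (intro D.indep_vars_restrict[OF indep_coords]) auto
    then have "D.indep_vars (\<lambda>_. borel) (\<lambda>k x. F k (restrict (\<lambda>i. x i) (L k))) {..<r}"
      by (rule D.indep_vars_compose2) (use F_meas in auto)
    then show ?thesis
      by (rule D.indep_vars_cong[THEN iffD1, rotated -1]) (auto simp: F_restrict)
  qed
  then have F_borel: "F k \<in> borel_measurable D" if "k < r" for k
    using that by (auto simp: D.indep_vars_def)
  have far_int: "integrable D (far M t b)" if "b \<in> B" for b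
    using that far_unit[of M t b] far_borel_D[of b M]
    by (intro D.integrable_const_bound[where B = 1]) (auto simp: B_def)
  have F_mean: "D.expectation (F k) = p" and F_int: "integrable D (F k)" if k: "k < r" for k
  proof -
    have 1: "D.expectation (\<lambda>x. far M t b (permuted (\<rho> b k) x)) = D.expectation (far M t b)"
      "integrable D (\<lambda>x. far M t b (permuted (\<rho> b k) x))" if b: "b \<in> B" for b
    proof -
      have \<pi>: "\<rho> b k permutes {1..n}" using \<rho>[OF b k] by simp
      have m: "far M t b \<in> borel_measurable D" using b far_borel_D by (simp add: B_def)
      show "D.expectation (\<lambda>x. far M t b (permuted (\<rho> b k) x)) = D.expectation (far M t b)"
        using integral_distr[OF permuted_measurable[OF \<pi>] m] permuted_distr[OF \<pi>] by simp
      show "integrable D (\<lambda>x. far M t b (permuted (\<rho> b k) x))"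
        using integrable_distr_eq[OF permuted_measurable[OF \<pi>] m] permuted_distr[OF \<pi>] far_int[OF b]
        by simp
    qed
    show "D.expectation (F k) = p" "integrable D (F k)"
      using 1 by (simp_all add: F_eq[abs_def] p_def)
  qed
  have p: "p \<in> {0..1}"
  proof -
    have "0 \<le> D.expectation (F 0)" using F_unit by (intro Bochner_Integration.integral_nonneg) auto
    moreover have "D.expectation (F 0) \<le> D.expectation (\<lambda>_. 1)"
      using F_unit F_int[OF r(1)] by (intro integral_mono) auto
    ultimately show ?thesis using F_mean[OF r(1)] by (simp add: D.prob_space)
  qed
  \<comment> \<open>\<open>F k\<close> has range 1, so Hoeffding's lemma at l / r gives (l / r)^2 /
    8; the product over \<open>r\<close> windows turns this into l^2 / (8 r).\<close>
  have mgf: "D.expectation (\<lambda>x. exp (l / r * F k x)) \<le> exp (l / r * p + (l / r)\<^sup>2 / 8)" if k: "k < r" for k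
  proof -
    have "D.expectation (\<lambda>x. exp (l / r * (F k x - p))) \<le> exp ((l / r)\<^sup>2 * ((1 - p) - (0 - p))\<^sup>2 / 8)"
    proof (rule D.Hoeffding_mgf_le)
      show "D.expectation (\<lambda>x. F k x - p) = 0"
        using F_mean[OF k] F_int[OF k] by (simp add: D.prob_space)
    qed (use F_borel[OF k] F_unit \<open>0 < l\<close> r in auto)
    also have "(\<lambda>x. exp (l / r * (F k x - p))) = (\<lambda>x. exp (- (l / r * p)) * exp (l / r * F k x))"
      by (simp add: fun_eq_iff algebra_simps flip: exp_add)
    finally have "exp (- (l / r * p)) * D.expectation (\<lambda>x. exp (l / r * F k x)) \<le> exp ((l / r)\<^sup>2 / 8)"
      by simp
    then show ?thesis by (simp add: exp_minus exp_add field_simps)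
  qed
  define perms where "perms = {\<pi>. \<pi> permutes {1..n}}"
  have fperms: "finite perms" "card perms > 0" "perms \<noteq> {}"
    unfolding perms_def using finite_permutations[of "{1..n}"] card_permutations[of "{1..n}" n]
    by (auto intro: permutes_id)
  define S where "S x = (\<Sum>k<r. F k x)" for x
  have S_borel: "S \<in> borel_measurable D" unfolding S_def[abs_def] using F_borel by auto
  have S_bound: "exp (l / r * S x) \<le> exp l" "0 \<le> S x" for x
  proof -
    have "S x \<le> (\<Sum>k<r. 1)" unfolding S_def using F_unit by (intro sum_mono) auto
    then show "exp (l / r * S x) \<le> exp l" using \<open>0 < l\<close> r by (simp add: field_simps)
    show "0 \<le> S x" unfolding S_def using F_unit by (intro sum_nonneg) auto
  qed
  have rep: "far_mean M t x = (\<Sum>\<pi>\<in>perms. S (permuted \<pi> x) / r) / card perms" if x: "x \<in> space D" for x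
  proof -
    \<comment> \<open>Composing with the fixed permutation \<open>\<rho> b k\<close> only reorders
      the sum over all permutations. This is why a different \<rho> may be chosen for each block and
      window.\<close>
    have *: "(\<Sum>\<pi>\<in>perms. far M t b (permuted \<pi> x)) = (\<Sum>\<pi>\<in>perms. far M t b (permuted (\<rho> b k) (permuted \<pi> x)))"
      if b: "b \<in> B" and k: "k < r" for b k
    proof -
      have \<pi>: "\<rho> b k permutes {1..n}" using \<rho>[OF b k] by simp
      show ?thesis
        unfolding perms_def permuted_permuted[OF \<pi>]
        by (rule sum_permutations_compose_right[OF \<pi>])
    qed
    have "card perms * far_mean M t x = (\<Sum>\<pi>\<in>perms. far_mean M t (permuted \<pi> x))"
      using x by (simp add: perms_def far_mean_permuted)
    also have "\<dots> = (\<Sum>b\<in>B. \<Sum>\<pi>\<in>perms. far M t b (permuted \<pi> x)) / card B"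
      unfolding far_mean_def inj_mean_def B_def sum_divide_distrib[symmetric] by (subst sum.swap) simp
    finally have W: "card perms * far_mean M t x = \<dots>" .
    have "(\<Sum>\<pi>\<in>perms. S (permuted \<pi> x)) = (\<Sum>k<r. \<Sum>\<pi>\<in>perms. F k (permuted \<pi> x))"
      unfolding S_def by (rule sum.swap)
    also have "\<dots> = (\<Sum>k<r. (\<Sum>b\<in>B. \<Sum>\<pi>\<in>perms. far M t b (permuted (\<rho> b k) (permuted \<pi> x))) / card B)"
      unfolding F_eq sum_divide_distrib[symmetric] by (intro sum.cong refl arg_cong2[of _ _ _ _ "(/)"] sum.swap)
    also have "\<dots> = (\<Sum>k<r. card perms * far_mean M t x)"
    proof (rule sum.cong[OF refl])
      fix k assume "k \<in> {..<r}"
      then have "(\<Sum>b\<in>B. \<Sum>\<pi>\<in>perms. far M t b (permuted \<pi> x))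
          = (\<Sum>b\<in>B. \<Sum>\<pi>\<in>perms. far M t b (permuted (\<rho> b k) (permuted \<pi> x)))"
        by (intro sum.cong[OF refl *]) auto
      then show "(\<Sum>b\<in>B. \<Sum>\<pi>\<in>perms. far M t b (permuted (\<rho> b k) (permuted \<pi> x))) / card B
          = card perms * far_mean M t x"
        unfolding W by simp
    qed
    finally have "(\<Sum>\<pi>\<in>perms. S (permuted \<pi> x)) = r * (card perms * far_mean M t x)" by simp
    then show ?thesis
      using r fperms by (auto simp: sum_divide_distrib[symmetric])
  qed
  have jensen: "exp (l * far_mean M t x) \<le> (\<Sum>\<pi>\<in>perms. exp (l / r * S (permuted \<pi> x)) / card perms)"
    if x: "x \<in> space D" for x
  proof -
    have "exp (l * (\<Sum>\<pi>\<in>perms. (1 / card perms) *\<^sub>R (S (permuted \<pi> x) / r)))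
        \<le> (\<Sum>\<pi>\<in>perms. 1 / card perms * exp (l * (S (permuted \<pi> x) / r)))"
      using fperms \<open>0 < l\<close> by (intro convex_on_sum[OF _ _ convex_on_exp]) auto
    then show ?thesis
      unfolding rep[OF x] by (simp add: sum_divide_distrib mult_ac)
  qed
  have int_S: "integrable D (\<lambda>x. exp (l / r * S x))"
    using S_borel S_bound by (intro D.integrable_const_bound[where B = "exp l"]) auto
  have int_perm: "integrable D (\<lambda>x. exp (l / r * S (permuted \<pi> x)))"
    "D.expectation (\<lambda>x. exp (l / r * S (permuted \<pi> x))) = D.expectation (\<lambda>x. exp (l / r * S x))"
    if "\<pi> \<in> perms" for \<pi>
  proof -
    have \<pi>: "\<pi> permutes {1..n}" using that by (simp add: perms_def)
    have m: "(\<lambda>x. exp (l / r * S x)) \<in> borel_measurable D" using S_borel by measurable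
    show "integrable D (\<lambda>x. exp (l / r * S (permuted \<pi> x)))"
      using integrable_distr_eq[OF permuted_measurable[OF \<pi>] m] permuted_distr[OF \<pi>] int_S by simp
    show "D.expectation (\<lambda>x. exp (l / r * S (permuted \<pi> x))) = D.expectation (\<lambda>x. exp (l / r * S x))"
      using integral_distr[OF permuted_measurable[OF \<pi>] m] permuted_distr[OF \<pi>] by simp
  qed
  have "D.expectation (\<lambda>x. exp (l * far_mean M t x))
      \<le> D.expectation (\<lambda>x. \<Sum>\<pi>\<in>perms. exp (l / r * S (permuted \<pi> x)) / card perms)"
  proof (rule integral_mono)
    show "integrable D (\<lambda>x. exp (l * far_mean M t x))"
      using far_mean_unit[of M t] \<open>0 < l\<close>
      by (intro D.integrable_const_bound[where B = "exp l"]) auto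
  qed (use jensen int_perm in auto)
  also have "\<dots> = (\<Sum>\<pi>\<in>perms. D.expectation (\<lambda>x. exp (l / r * S (permuted \<pi> x))) / card perms)"
    using int_perm by (subst Bochner_Integration.integral_sum) auto
  also have "\<dots> = D.expectation (\<lambda>x. exp (l / r * S x))"
    using fperms int_perm by simp
  also have "\<dots> = D.expectation (\<lambda>x. \<Prod>k<r. exp (l / r * F k x))"
    by (simp add: S_def sum_distrib_left exp_sum)
  also have "\<dots> = (\<Prod>k<r. D.expectation (\<lambda>x. exp (l / r * F k x)))"
  proof (rule D.indep_vars_lebesgue_integral)
    show "D.indep_vars (\<lambda>_. borel) (\<lambda>k x. exp (l / r * F k x)) {..<r}"
      by (rule D.indep_vars_compose2[OF F_indep]) auto
    show "integrable D (\<lambda>x. exp (l / r * F k x))" if "k \<in> {..<r}" for k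
      using F_borel[of k] F_unit[of k] that \<open>0 < l\<close> r
      by (intro D.integrable_const_bound[where B = "exp (l / r)"]) (auto simp: field_simps)
  qed simp
  also have "\<dots> \<le> (\<Prod>k<r. exp (l / r * p + (l / r)\<^sup>2 / 8))"
    using mgf by (intro prod_mono) (auto intro: Bochner_Integration.integral_nonneg)
  also have "\<dots> = exp (r * (l / r * p + (l / r)\<^sup>2 / 8))"
    by (simp add: exp_of_nat_mult)
  also have "r * (l / r * p + (l / r)\<^sup>2 / 8) = l * p + l\<^sup>2 / (8 * real r)"
    using r by (simp add: field_simps power2_eq_square)
  finally show ?thesis .
qed

lemma far_mean_tail:
  assumes M: "0 < M" and r: "0 < r" "2 * M * r \<le> n" and "0 < \<tau>"
  defines "B \<equiv> inj_maps {1..M} (index_pairs n)"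
  assumes p: "(\<Sum>b\<in>B. D.expectation (far M t b)) \<le> card B * (\<tau> / 3)"
  shows "D.prob {x \<in> space D. \<tau> \<le> far_mean M t x} \<le> exp (- 8 * real r * \<tau>\<^sup>2 / 9)"
proof -
  \<comment> \<open>The minimiser of l^2 / (8 r) - 2 l \<tau> / 3, where 2 \<tau> / 3 is the
    distance from \<tau> to the bound \<tau> / 3 on the mean.\<close>
  define l where "l = 8 * real r * \<tau> / 3"
  have "0 < l" using \<open>0 < \<tau>\<close> r by (simp add: l_def)
  define q where "q = (\<Sum>b\<in>B. D.expectation (far M t b)) / card B"
  have q: "q \<le> \<tau> / 3"
    using p \<open>0 < \<tau>\<close> by (cases "card B = 0") (auto simp: q_def field_simps)
  have "D.expectation (\<lambda>x. exp (l * far_mean M t x)) \<le> exp (l * q + l\<^sup>2 / (8 * real r))"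
    unfolding q_def B_def using M r \<open>0 < l\<close> by (rule far_mean_mgf)
  moreover have "D.prob {x \<in> space D. exp (l * \<tau>) \<le> exp (l * far_mean M t x)}
      \<le> D.expectation (\<lambda>x. exp (l * far_mean M t x)) / exp (l * \<tau>)"
  proof (rule integral_Markov_inequality_measure[where A = "{}"])
    show "integrable D (\<lambda>x. exp (l * far_mean M t x))"
      using far_mean_unit[of M t] \<open>0 < l\<close>
      by (intro D.integrable_const_bound[where B = "exp l"]) auto
  qed auto
  moreover have "{x \<in> space D. exp (l * \<tau>) \<le> exp (l * far_mean M t x)} = {x \<in> space D. \<tau> \<le> far_mean M t x}"
    using \<open>0 < l\<close> by auto
  ultimately have "D.prob {x \<in> space D. \<tau> \<le> far_mean M t x}
      \<le> exp (l * q + l\<^sup>2 / (8 * real r)) / exp (l * \<tau>)"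
    by (smt (verit) divide_right_mono exp_ge_zero)
  also have "\<dots> = exp (l * q + l\<^sup>2 / (8 * real r) - l * \<tau>)" by (simp add: exp_diff)
  also have "l * q \<le> l * (\<tau> / 3)" using q \<open>0 < l\<close> by simp
  also have "l * (\<tau> / 3) + l\<^sup>2 / (8 * real r) - l * \<tau> = - 8 * real r * \<tau>\<^sup>2 / 9"
    using r by (simp add: l_def field_simps power2_eq_square)
  finally show ?thesis by simp
qed

end

subsection \<open>The sample median\<close>

text \<open>For a downward closed \<open>P\<close> the entries satisfying it form an initial segment
  of the sorted list, so an order statistic is decided by a count. Both the deviation bound and the
  measurability of the median use this.\<close>

lemma sort_nth_iff:
  fixes xs :: "'a :: linorder list"
  assumes P: "\<And>x y. x \<le> y \<Longrightarrow> P y \<Longrightarrow> P x" and i: "i < length xs"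
  shows "P (sort xs ! i) \<longleftrightarrow> i < length (filter P xs)"
proof -
  have "length (filter P xs) = length (filter P (sort xs))"
    by (metis mset_filter mset_sort size_mset)
  also have "\<dots> = card {j. j < length xs \<and> P (sort xs ! j)}"
    by (simp add: length_filter_conv_card)
  finally have len: "length (filter P xs) = \<dots>" .
  have mono: "sort xs ! j \<le> sort xs ! k" if "j \<le> k" "k < length xs" for j k
    using that by (intro sorted_nth_mono) auto
  show ?thesis
  proof
    assume "P (sort xs ! i)"
    then have "{..i} \<subseteq> {j. j < length xs \<and> P (sort xs ! j)}" using P mono i by force
    from card_mono[OF _ this] show "i < length (filter P xs)" by (simp add: len)
  next
    assume *: "i < length (filter P xs)"
    show "P (sort xs ! i)"
    proof (rule ccontr)
      assume "\<not> P (sort xs ! i)"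
      then have "{j. j < length xs \<and> P (sort xs ! j)} \<subseteq> {..<i}"
        using P mono by (metis (no_types, lifting) lessThan_iff linorder_le_less_linear mem_Collect_eq subsetI)
      from card_mono[OF _ this] * show False by (simp add: len)
    qed
  qed
qed

text \<open>A strict majority within \<open>t\<close> of \<open>c\<close> leaves fewer than half of
  the entries below c - t and puts more than half at or below c + t, which confines the middle
  entries.\<close>

lemma sample_median_close:
  fixes xs :: "real list"
  assumes "length xs < 2 * length (filter (\<lambda>x. \<bar>x - c\<bar> \<le> t) xs)"
  shows "\<bar>sample_median xs - c\<bar> \<le> t"
proof -
  let ?s = "sort xs" and ?l = "length xs"
  have "length (filter (\<lambda>x. \<bar>x - c\<bar> \<le> t) xs) \<le> length (filter (\<lambda>x. x \<le> c + t) xs)"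
    by (induction xs) auto
  with assms have up: "?l < 2 * length (filter (\<lambda>x. x \<le> c + t) xs)" by simp
  have "length (filter (\<lambda>x. \<bar>x - c\<bar> \<le> t) xs) + length (filter (\<lambda>x. x < c - t) xs) \<le> ?l"
    by (induction xs) auto
  with assms have lo: "2 * length (filter (\<lambda>x. x < c - t) xs) < ?l" by linarith
  \<comment> \<open>The conditions on \<open>i\<close> select exactly the middle positions:
    \<open>?l div 2\<close>, and for even length also the position before it.\<close>
  have close: "?s ! i \<le> c + t" "c - t \<le> ?s ! i" if "i \<le> ?l div 2" "?l \<le> 2 * i + 2" "i < ?l" for i
  proof -
    show "?s ! i \<le> c + t"
      using that up by (subst sort_nth_iff[where P = "\<lambda>x. x \<le> c + t"]) auto
    have "\<not> ?s ! i < c - t"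
      using that lo by (subst sort_nth_iff[where P = "\<lambda>x. x < c - t"]) auto
    then show "c - t \<le> ?s ! i" by simp
  qed
  have l: "0 < ?l" using lo by linarith
  show ?thesis
  proof (cases "odd ?l")
    case True
    then show ?thesis
      using close[of "?l div 2"] l by (auto simp: sample_median_def abs_le_iff elim!: oddE)
  next
    case False
    then obtain j where "?l = 2 * j" by blast
    with l obtain i where "?l = 2 * Suc i" by (cases j) auto
    then show ?thesis
      using close[of i] close[of "Suc i"] by (auto simp: sample_median_def Let_def abs_le_iff field_simps)
  qed
qed

lemma sample_median_borel:
  fixes u :: "'k \<Rightarrow> 'a \<Rightarrow> real"
  assumes u: "\<And>k. k \<in> set ks \<Longrightarrow> u k \<in> borel_measurable N" and "ks \<noteq> []"
  shows "(\<lambda>x. sample_median (map (\<lambda>k. u k x) ks)) \<in> borel_measurable N"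
proof -
  have count: "(\<lambda>x. length (filter (\<lambda>k. u k x \<le> c) ks')) \<in> measurable N (count_space UNIV)"
    if "set ks' \<subseteq> set ks" for c ks'
    using that
  proof (induction ks')
    case (Cons k ks')
    then have [measurable]: "u k \<in> borel_measurable N"
      "(\<lambda>x. length (filter (\<lambda>k. u k x \<le> c) ks')) \<in> measurable N (count_space UNIV)"
      using u by auto
    have "(\<lambda>x. length (filter (\<lambda>k. u k x \<le> c) (k # ks')))
        = (\<lambda>x. if u k x \<le> c then Suc (length (filter (\<lambda>k. u k x \<le> c) ks'))
            else length (filter (\<lambda>k. u k x \<le> c) ks'))" by auto
    then show ?case by simp
  qed simp
  have [measurable]: "(\<lambda>x. sort (map (\<lambda>k. u k x) ks) ! i) \<in> borel_measurable N" if i: "i < length ks" for i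
  proof (rule borel_measurableI_le)
    fix c
    have [measurable]: "(\<lambda>x. length (filter (\<lambda>k. u k x \<le> c) ks)) \<in> measurable N (count_space UNIV)"
      using count by simp
    have "{x \<in> space N. sort (map (\<lambda>k. u k x) ks) ! i \<le> c}
        = {x \<in> space N. i < length (filter (\<lambda>k. u k x \<le> c) ks)}"
      using i by (subst sort_nth_iff[where P = "\<lambda>x. x \<le> c"]) (auto simp: filter_map comp_def)
    also have "\<dots> \<in> sets N" by measurable
    finally show "{x \<in> space N. sort (map (\<lambda>k. u k x) ks) ! i \<le> c} \<in> sets N" .
  qed
  have "0 < length ks" using assms(2) by simp
  then have "length ks div 2 < length ks" "length ks div 2 - 1 < length ks" by linarith+
  then show ?thesis
    unfolding sample_median_def Let_def length_map by (cases "odd (length ks)") auto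
qed

section \<open>From far blocks to a far median\<close>

context kernel_sample
begin

definition med :: "nat \<Rightarrow> nat \<Rightarrow> (nat \<times> nat \<Rightarrow> nat \<times> nat) \<Rightarrow> (nat \<Rightarrow> 'z) \<Rightarrow> real" where
  "med K M f x = sample_median (map (\<lambda>k. pair_mean M h (block {1..M} k f) x) [1..<K + 1])"

lemma block_in_inj_maps:
  assumes "f \<in> inj_maps ({1..K} \<times> {1..M}) A" "k \<in> {1..K}"
  shows "block {1..M} k f \<in> inj_maps {1..M} A"
proof -
  have f: "f \<in> {1..K} \<times> {1..M} \<rightarrow>\<^sub>E A" "inj_on f ({1..K} \<times> {1..M})"
    using assms(1) by (auto simp: inj_maps_def)
  have "inj_on (block {1..M} k f) {1..M}"
  proof (rule inj_onI)
    fix m m' assume m: "m \<in> {1..M}" "m' \<in> {1..M}" "block {1..M} k f m = block {1..M} k f m'"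
    then have "f (k, m) = f (k, m')" unfolding block_def by simp
    then have "(k, m) = (k, m')" using m assms(2) by (intro inj_onD[OF f(2)]) auto
    then show "m = m'" by simp
  qed
  moreover have "f (k, m) \<in> A" if "m \<in> {1..M}" for m
    using that assms(2) by (intro PiE_mem[OF f(1)]) auto
  then have "block {1..M} k f \<in> {1..M} \<rightarrow>\<^sub>E A" by (auto simp: block_def)
  ultimately show ?thesis by (simp add: inj_maps_def)
qed

lemma med_borel:
  assumes "f \<in> inj_maps ({1..K} \<times> {1..M}) (index_pairs n)" "0 < K"
  shows "med K M f \<in> borel_measurable D"
  unfolding med_def[abs_def]
  by (intro sample_median_borel pair_mean_borel_D block_in_inj_maps[OF assms(1)]) (use assms in auto)

lemma med_far_imp:
  assumes "t < \<bar>med K M f x - mean\<bar>"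
  shows "real K / 2 \<le> (\<Sum>k=1..K. far M t (block {1..M} k f) x)"
proof -
  let ?u = "\<lambda>k. pair_mean M h (block {1..M} k f) x"
  have "length (filter (\<lambda>y. \<bar>y - mean\<bar> \<le> t) (map ?u [1..<K + 1]))
      = card {k \<in> {1..K}. \<bar>?u k - mean\<bar> \<le> t}"
  proof -
    have "length (filter (\<lambda>k. \<bar>?u k - mean\<bar> \<le> t) [1..<K + 1])
        = card (set (filter (\<lambda>k. \<bar>?u k - mean\<bar> \<le> t) [1..<K + 1]))"
      by (intro distinct_card[symmetric] distinct_filter) simp
    also have "set (filter (\<lambda>k. \<bar>?u k - mean\<bar> \<le> t) [1..<K + 1]) = {k \<in> {1..K}. \<bar>?u k - mean\<bar> \<le> t}"
      by auto
    finally show ?thesis by (simp add: filter_map comp_def)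
  qed
  moreover have "\<not> length (map ?u [1..<K + 1]) < 2 * length (filter (\<lambda>y. \<bar>y - mean\<bar> \<le> t) (map ?u [1..<K + 1]))"
    using sample_median_close[of "map ?u [1..<K + 1]" mean t] assms by (auto simp: med_def)
  ultimately have c: "2 * card {k \<in> {1..K}. \<bar>?u k - mean\<bar> \<le> t} \<le> K"
    unfolding length_map length_upt by linarith
  have "(\<Sum>k=1..K. far M t (block {1..M} k f) x) = (\<Sum>k=1..K. 1 - (if \<bar>?u k - mean\<bar> \<le> t then 1 else 0))"
    by (intro sum.cong) (auto simp: far_def)
  also have "\<dots> = real K - card {k \<in> {1..K}. \<bar>?u k - mean\<bar> \<le> t}"
    by (simp add: sum_subtractf sum.If_cases Int_def)
  finally show ?thesis using c by simp
qed

text \<open>The sample \<open>x\<close> is fixed and only the draws vary, so probabilities are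
  ratios of counts and \<open>blocks_tail\<close> applies with deviation 1/2 - \<tau>.\<close>

lemma card_far_draws_le:
  assumes "0 < M" "\<tau> < 1 / 2" "far_mean M t x < \<tau>"
    and KM: "K * M\<^sup>2 \<le> 3 / 2 * (card (index_pairs n) - real K * M)"
  defines "F \<equiv> inj_maps ({1..K} \<times> {1..M}) (index_pairs n)"
  shows "card {f \<in> F. t < \<bar>med K M f x - mean\<bar>} \<le> card F * exp (- real K * (1 / 2 - \<tau>)\<^sup>2 / 8)"
proof -
  let ?E = "{f \<in> F. K * (inj_mean {1..M} (index_pairs n) (\<lambda>b. far M t b x) + (1 / 2 - \<tau>))
    \<le> (\<Sum>k=1..K. far M t (block {1..M} k f) x)}"
  have "finite F" by (simp add: F_def)
  have "{f \<in> F. t < \<bar>med K M f x - mean\<bar>} \<subseteq> ?E"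
  proof safe
    fix f assume "t < \<bar>med K M f x - mean\<bar>"
    have "K * (far_mean M t x + (1 / 2 - \<tau>)) \<le> K * (1 / 2)"
      using assms by (intro mult_left_mono) auto
    also have "\<dots> \<le> (\<Sum>k=1..K. far M t (block {1..M} k f) x)"
      using med_far_imp[OF \<open>t < _\<close>] by simp
    finally show "K * (inj_mean {1..M} (index_pairs n) (\<lambda>b. far M t b x) + (1 / 2 - \<tau>))
        \<le> (\<Sum>k=1..K. far M t (block {1..M} k f) x)"
      by (simp add: far_mean_def)
  qed
  then have "card {f \<in> F. t < \<bar>med K M f x - mean\<bar>} \<le> card ?E"
    using \<open>finite F\<close> by (intro card_mono) auto
  moreover have "card ?E \<le> card F * exp (- real K * (1 / 2 - \<tau>)\<^sup>2 / 8)"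
    unfolding F_def using assms far_unit by (intro blocks_tail) auto
  ultimately show ?thesis by linarith
qed

text \<open>The sum of the probabilities is the expected number of bad draws. On \<open>Q\<close>
  every draw may be bad; off \<open>Q\<close> at most the fraction \<open>e\<close> is.\<close>

lemma sum_prob_med_far_le:
  assumes "0 < M" "0 < K" "0 < \<tau>" "\<tau> < 1 / 2" "0 \<le> t"
    and r: "0 < r" "2 * M * r \<le> n"
    and KM: "K * M\<^sup>2 \<le> 3 / 2 * (card (index_pairs n) - real K * M)"
    and v: "var / M + 4 * var1 / (real n + 1) \<le> \<tau> / 3 * t\<^sup>2"
  defines "F \<equiv> inj_maps ({1..K} \<times> {1..M}) (index_pairs n)"
  shows "(\<Sum>f\<in>F. D.prob {x \<in> space D. t < \<bar>med K M f x - mean\<bar>})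
    \<le> card F * (exp (- 8 * real r * \<tau>\<^sup>2 / 9) + exp (- real K * (1 / 2 - \<tau>)\<^sup>2 / 8))"
proof -
  define e where "e = exp (- real K * (1 / 2 - \<tau>)\<^sup>2 / 8)"
  define Q where "Q = {x \<in> space D. \<tau> \<le> far_mean M t x}"
  define R where "R f = {x \<in> space D. t < \<bar>med K M f x - mean\<bar>}" for f
  have fF: "finite F" by (simp add: F_def)
  have Q [measurable]: "Q \<in> sets D" unfolding Q_def by measurable
  have R [measurable]: "R f \<in> sets D" if "f \<in> F" for f
  proof -
    have [measurable]: "med K M f \<in> borel_measurable D" using that assms by (intro med_borel) (auto simp: F_def)
    show ?thesis unfolding R_def by measurable
  qed
  have "(\<Sum>f\<in>F. D.prob (R f)) = D.expectation (\<lambda>x. \<Sum>f\<in>F. indicator (R f) x)"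
    using R by (subst Bochner_Integration.integral_sum) (auto simp: integrable_real_indicator less_top[symmetric])
  also have "\<dots> \<le> D.expectation (\<lambda>x. card F * (indicator Q x + e))"
  proof (rule integral_mono)
    show "integrable D (\<lambda>x. \<Sum>f\<in>F. indicat_real (R f) x)"
      using R by (intro Bochner_Integration.integrable_sum) (auto simp: less_top[symmetric])
    show "integrable D (\<lambda>x. card F * (indicat_real Q x + e))"
      using Q by (auto simp: less_top[symmetric])
    fix x assume x: "x \<in> space D"
    have eq: "(\<Sum>f\<in>F. indicat_real (R f) x) = card {f \<in> F. t < \<bar>med K M f x - mean\<bar>}"
      using fF x by (simp add: R_def indicator_def sum.If_cases Int_def)
    show "(\<Sum>f\<in>F. indicat_real (R f) x) \<le> card F * (indicator Q x + e)"
    proof (cases "x \<in> Q")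
      case True
      have "card {f \<in> F. t < \<bar>med K M f x - mean\<bar>} \<le> card F" using fF by (intro card_mono) auto
      then have "real (card {f \<in> F. t < \<bar>med K M f x - mean\<bar>}) \<le> real (card F) * 1" by simp
      also have "\<dots> \<le> card F * (1 + e)" by (intro mult_left_mono) (auto simp: e_def)
      finally show ?thesis using True by (simp add: eq)
    next
      case False
      then have "far_mean M t x < \<tau>" using x by (auto simp: Q_def)
      then have "card {f \<in> F. t < \<bar>med K M f x - mean\<bar>} \<le> card F * e"
        unfolding F_def e_def using assms by (intro card_far_draws_le) auto
      then show ?thesis unfolding eq using False by simp
    qed
  qed
  also have "\<dots> = card F * (D.prob Q + e)"
    using Q by (simp add: D.prob_space less_top[symmetric])
  also have "\<dots> \<le> card F * (exp (- 8 * real r * \<tau>\<^sup>2 / 9) + e)"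
  proof -
    have "(\<Sum>b\<in>inj_maps {1..M} (index_pairs n). D.expectation (far M t b))
        \<le> card (inj_maps {1..M} (index_pairs n)) * (\<tau> / 3)"
      using assms by (intro sum_far_le) auto
    then have "D.prob Q \<le> exp (- 8 * real r * \<tau>\<^sup>2 / 9)"
      unfolding Q_def using assms by (intro far_mean_tail) auto
    then show ?thesis by (intro mult_left_mono) auto
  qed
  finally show ?thesis by (simp add: R_def e_def)
qed

end

subsection \<open>Conditional expectation and numerical estimates\<close>

context kernel_sample
begin

definition proj1 :: "'z \<Rightarrow> real" where "proj1 x = (\<integral>y. h x y \<partial>\<mu>)"

lemma proj1_borel [measurable]: "proj1 \<in> borel_measurable \<mu>"
  unfolding proj1_def[abs_def] by measurable

lemma proj1_integrable: "integrable \<mu> proj1"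
  using pp.integrable_fst'[OF h_integrable] by (simp add: proj1_def[abs_def])

lemma indicator_proj1:
  assumes [measurable]: "B \<in> sets \<mu>"
  shows "(\<integral>x. indicator B x * proj1 x \<partial>\<mu>)
    = (\<integral>p. indicator B (fst p) * h (fst p) (snd p) \<partial>(\<mu> \<Otimes>\<^sub>M \<mu>))"
proof -
  have "integrable (\<mu> \<Otimes>\<^sub>M \<mu>) (\<lambda>p. indicator B (fst p) * h (fst p) (snd p))"
    by (rule Bochner_Integration.integrable_bound[OF h_integrable]) (auto simp: indicator_def)
  from pp.integral_fst'[OF this] show ?thesis by (simp add: proj1_def)
qed

lemma proj1_mean: "(\<integral>x. proj1 x \<partial>\<mu>) = mean"
  using pp.integral_fst'[OF h_integrable] by (simp add: proj1_def mean_def case_prod_unfold)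

lemma proj1_var: "(\<integral>x. (proj1 x - mean)\<^sup>2 \<partial>\<mu>) = var1"
  unfolding var1_def
proof (rule integral_cong_AE)
  have "AE x in \<mu>. integrable \<mu> (\<lambda>y. h x y)"
    using pp.AE_integrable_fst'[OF h_integrable] by simp
  then show "AE x in \<mu>. (proj1 x - mean)\<^sup>2 = (h1 x)\<^sup>2"
  proof eventually_elim
    fix x assume "integrable \<mu> (\<lambda>y. h x y)"
    then show "(proj1 x - mean)\<^sup>2 = (h1 x)\<^sup>2"
      by (simp add: proj1_def h1_def h0_def prob_space)
  qed
qed (auto simp: h1_def)

text \<open>The conditional expectation is \<open>proj1\<close> at the first observation: by Fubini
  for the joint law, the integrals agree over every event generated by \<open>X1\<close>.
  \<open>Z\<close> appears beside \<mu> because \<open>sigma1_sq\<close> conditions through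
  \<open>Z\<close>; both have the same measurable sets.\<close>

lemma variance_cond_exp:
  assumes P: "prob_space P" and X1: "X1 \<in> measurable P \<mu>" and X2: "X2 \<in> measurable P \<mu>"
    and joint: "distr P (\<mu> \<Otimes>\<^sub>M \<mu>) (\<lambda>\<omega>. (X1 \<omega>, X2 \<omega>)) = \<mu> \<Otimes>\<^sub>M \<mu>"
    and law1: "distr P \<mu> X1 = \<mu>"
    and Z: "sets Z = sets \<mu>"
  shows "prob_space.variance P
    (real_cond_exp P (vimage_algebra (space P) X1 Z) (\<lambda>\<omega>. h (X1 \<omega>) (X2 \<omega>))) = var1"
proof -
  interpret P: prob_space P by fact
  note [measurable] = X1 X2
  have pair [measurable]: "(\<lambda>\<omega>. (X1 \<omega>, X2 \<omega>)) \<in> measurable P (\<mu> \<Otimes>\<^sub>M \<mu>)" by measurable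
  have spZ: "space Z = space \<mu>" using Z by (rule sets_eq_imp_space_eq)
  have X1sp: "X1 \<in> space P \<rightarrow> space Z" using X1 spZ by (auto simp: measurable_def)
  define F where "F = vimage_algebra (space P) X1 Z"
  have setsF: "sets F = {X1 -` B \<inter> space P | B. B \<in> sets \<mu>}"
    unfolding F_def using sets_vimage_algebra2[OF X1sp] Z by simp
  have "subalgebra P F"
    unfolding subalgebra_def setsF using X1 by (auto simp: F_def dest: measurable_sets)
  then interpret F: finite_measure_subalgebra P F
    by unfold_locales
  have X1F: "X1 \<in> measurable F \<mu>"
    unfolding F_def using measurable_vimage_algebra1[OF X1sp] measurable_cong_sets[OF refl Z] by blast
  define C where "C = real_cond_exp P F (\<lambda>\<omega>. h (X1 \<omega>) (X2 \<omega>))"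
  have C [measurable]: "C \<in> borel_measurable P"
    unfolding C_def by (rule borel_measurable_cond_exp2)
  have AE_C: "AE \<omega> in P. C \<omega> = proj1 (X1 \<omega>)"
    unfolding C_def
  proof (rule F.real_cond_exp_charact)
    show "integrable P (\<lambda>\<omega>. h (X1 \<omega>) (X2 \<omega>))"
      using integrable_distr_eq[OF pair, of "\<lambda>p. h (fst p) (snd p)"] h_integrable joint by simp
    show "integrable P (\<lambda>\<omega>. proj1 (X1 \<omega>))"
      using integrable_distr_eq[OF X1 proj1_borel] proj1_integrable law1 by simp
    show "(\<lambda>\<omega>. proj1 (X1 \<omega>)) \<in> borel_measurable F"
      using measurable_compose[OF X1F proj1_borel] .
    fix A assume "A \<in> sets F"
    then obtain B where B [measurable]: "B \<in> sets \<mu>" and A: "A = X1 -` B \<inter> space P" by (auto simp: setsF)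
    have "(\<integral>\<omega>\<in>A. h (X1 \<omega>) (X2 \<omega>) \<partial>P) = (\<integral>\<omega>. indicator B (X1 \<omega>) * h (X1 \<omega>) (X2 \<omega>) \<partial>P)"
      unfolding set_lebesgue_integral_def
      by (intro Bochner_Integration.integral_cong) (auto simp: A indicator_def)
    also have "\<dots> = (\<integral>p. indicator B (fst p) * h (fst p) (snd p) \<partial>(\<mu> \<Otimes>\<^sub>M \<mu>))"
      using integral_distr[OF pair, of "\<lambda>p. indicator B (fst p) * h (fst p) (snd p)"] joint by simp
    also have "\<dots> = (\<integral>x. indicator B x * proj1 x \<partial>\<mu>)" by (simp add: indicator_proj1)
    also have "\<dots> = (\<integral>\<omega>. indicator B (X1 \<omega>) * proj1 (X1 \<omega>) \<partial>P)"
      using integral_distr[OF X1, of "\<lambda>x. indicator B x * proj1 x"] law1 by simp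
    also have "\<dots> = (\<integral>\<omega>\<in>A. proj1 (X1 \<omega>) \<partial>P)"
      unfolding set_lebesgue_integral_def
      by (intro Bochner_Integration.integral_cong) (auto simp: A indicator_def)
    finally show "(\<integral>\<omega>\<in>A. h (X1 \<omega>) (X2 \<omega>) \<partial>P) = (\<integral>\<omega>\<in>A. proj1 (X1 \<omega>) \<partial>P)" .
  qed
  have m1: "(\<lambda>\<omega>. proj1 (X1 \<omega>)) \<in> borel_measurable P" by measurable
  have EC: "P.expectation C = mean"
  proof -
    have "P.expectation C = P.expectation (\<lambda>\<omega>. proj1 (X1 \<omega>))"
      using AE_C by (intro integral_cong_AE) auto
    also have "\<dots> = mean"
      using integral_distr[OF X1 proj1_borel] law1 proj1_mean by simp
    finally show ?thesis .
  qed
  have "P.expectation (\<lambda>\<omega>. (C \<omega> - mean)\<^sup>2) = P.expectation (\<lambda>\<omega>. (proj1 (X1 \<omega>) - mean)\<^sup>2)"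
    using AE_C by (intro integral_cong_AE) auto
  also have "\<dots> = var1"
    using integral_distr[OF X1, of "\<lambda>x. (proj1 x - mean)\<^sup>2"] law1 proj1_var by simp
  finally show ?thesis using EC by (simp add: C_def F_def)
qed

end

section \<open>Arithmetic of the sample size, the block size and the number of blocks\<close>

lemma block_size_bounds:
  fixes \<tau> L :: real and n K M :: nat
  assumes \<tau>: "0 < \<tau>" "\<tau> < 1 / 2" and L: "2 / 3 \<le> L"
    and n: "9 * L / (2 * \<tau>\<^sup>2) \<le> n"
    and K: "K = nat \<lceil>8 / (1 / 2 - \<tau>)\<^sup>2 * L\<rceil>"
    and M: "M = nat \<lfloor>2 * real n * \<tau>\<^sup>2 / (9 * L)\<rfloor>"
  shows "12 \<le> n" "1 \<le> M" "M \<le> 2 * real n * \<tau>\<^sup>2 / (9 * L)" "1 / M \<le> 9 * L / (n * \<tau>\<^sup>2)"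
    "1 \<le> K" "8 * L \<le> K * (1 / 2 - \<tau>)\<^sup>2" "K * (1 / 2 - \<tau>)\<^sup>2 \<le> 67 / 8 * L"
proof -
  have \<tau>2: "0 < \<tau>\<^sup>2" "\<tau>\<^sup>2 < 1 / 4" "\<tau>\<^sup>2 * n * 2 \<ge> 9 * L"
    using \<tau> n power_strict_mono[of \<tau> "1 / 2" 2] by (auto simp: power_divide field_simps)
  \<comment> \<open>9 L is at least 6, and 2 \<tau>^2 n is at most n / 2.\<close>
  have "12 \<le> real n"
  proof -
    have "9 * L \<le> \<tau>\<^sup>2 * n * 2" by (rule \<tau>2)
    also have "\<dots> \<le> 1 / 4 * n * 2" using \<tau>2 by (intro mult_right_mono) auto
    finally show ?thesis using L by simp
  qed
  then show n12: "12 \<le> n" by simp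
  define y where "y = 2 * real n * \<tau>\<^sup>2 / (9 * L)"
  have y: "1 \<le> y" using \<tau>2 L by (simp add: y_def field_simps)
  then have y1: "1 \<le> \<lfloor>y\<rfloor>" by simp
  have "M = nat \<lfloor>y\<rfloor>" using M by (simp add: y_def)
  with y1 have My: "1 \<le> M" "real M = \<lfloor>y\<rfloor>" by linarith+
  then show "1 \<le> M" by simp
  show "M \<le> 2 * real n * \<tau>\<^sup>2 / (9 * L)" using My(2) by (simp flip: y_def)
  have "y < M + 1" using My by linarith
  \<comment> \<open>From y < M + 1 \<le> 2 M: rounding down loses at most a factor 2. The resulting
    9, times the 3 from the level \<tau> / 3, is the 27 of the theorem.\<close>
  then have "y / 2 \<le> M" using My by linarith
  then have "1 / M \<le> 1 / (y / 2)" using y by (intro divide_left_mono) auto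
  also have "\<dots> = 9 * L / (n * \<tau>\<^sup>2)" by (simp add: y_def)
  finally show "1 / M \<le> 9 * L / (n * \<tau>\<^sup>2)" .
  define s where "s = (1 / 2 - \<tau>)\<^sup>2"
  have s: "0 < s" "s < 1 / 4"
    using \<tau> power_strict_mono[of "1 / 2 - \<tau>" "1 / 2" 2] by (auto simp: s_def power_divide)
  have z: "0 < 8 / s * L" using s L by simp
  then have Kc: "real K = \<lceil>8 / s * L\<rceil>" by (simp add: K s_def)
  have "0 < real K" unfolding Kc using z by simp
  then show "1 \<le> K" by simp
  have "8 / s * L \<le> K" unfolding Kc by (rule le_of_int_ceiling)
  then show "8 * L \<le> K * (1 / 2 - \<tau>)\<^sup>2" unfolding s_def[symmetric] using s by (simp add: field_simps)
  have "real K \<le> 8 / s * L + 1" unfolding Kc by linarith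
  then have "K * s \<le> (8 / s * L + 1) * s" using s by (intro mult_right_mono) auto
  also have "\<dots> = 8 * L + s" using s by (simp add: field_simps)
  \<comment> \<open>\<open>s\<close> is the square here; it is below 1/4 = (3/8) (2/3), hence at
    most 3 L / 8, and 8 + 3/8 = 67/8.\<close>
  also have "\<dots> \<le> 67 / 8 * L" using s L by simp
  finally show "K * (1 / 2 - \<tau>)\<^sup>2 \<le> 67 / 8 * L" by (simp add: s_def)
qed

text \<open>This is where the hypothesis on \<^const>\<open>g\<close> enters.\<close>

lemma few_draws:
  fixes \<tau> L s :: real and n K M :: nat
  assumes "0 < s" "0 < L" "12 \<le> n" "1 \<le> M"
    and M: "M \<le> 2 * real n * \<tau>\<^sup>2 / (9 * L)"
    and K: "K * s\<^sup>2 \<le> 67 / 8 * L"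
    and g: "4 * \<tau> ^ 4 / (9 * s\<^sup>2 * L) \<le> 1 / 4"
  shows "K * M\<^sup>2 \<le> 3 / 2 * (card (index_pairs n) - real K * M)"
proof -
  have g': "16 * \<tau> ^ 4 \<le> 9 * s\<^sup>2 * L" using g assms(1,2) by (simp add: field_simps)
  have "9 * L * M \<le> 2 * real n * \<tau>\<^sup>2" using M assms(2) by (simp add: field_simps)
  then have "(9 * L * M)\<^sup>2 \<le> (2 * real n * \<tau>\<^sup>2)\<^sup>2" using assms by (intro power_mono) auto
  then have m: "81 * L\<^sup>2 * (real M)\<^sup>2 \<le> 4 * (real n)\<^sup>2 * \<tau> ^ 4"
    by (simp add: power_mult_distrib flip: power_mult)
  have "(K * s\<^sup>2) * (81 * L\<^sup>2 * (real M)\<^sup>2) \<le> (67 / 8 * L) * (4 * (real n)\<^sup>2 * \<tau> ^ 4)"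
    by (rule mult_mono[OF K m]) (use assms in auto)
  also have "\<dots> = 67 / 32 * L * (real n)\<^sup>2 * (16 * \<tau> ^ 4)" by simp
  also have "\<dots> \<le> 67 / 32 * L * (real n)\<^sup>2 * (9 * s\<^sup>2 * L)"
    using g' assms by (intro mult_left_mono) auto
  finally have "(s\<^sup>2 * L\<^sup>2) * (81 * (K * (real M)\<^sup>2)) \<le> (s\<^sup>2 * L\<^sup>2) * (603 / 32 * (real n)\<^sup>2)"
    by (simp add: power2_eq_square mult_ac)
  \<comment> \<open>That is, K M^2 is at most (67/8) (4/81) (9/16) n^2 = (67/288) n^2.\<close>
  then have KM: "81 * (K * (real M)\<^sup>2) \<le> 603 / 32 * (real n)\<^sup>2"
    using assms by (subst (asm) mult_le_cancel_left_pos) auto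
  have KM2: "real K * M \<le> K * (real M)\<^sup>2"
    using assms by (intro mult_left_mono) (auto simp: power2_eq_square)
  have pairs: "real (card (index_pairs n)) = real n * (real n - 1) / 2"
    using arg_cong[OF card_index_pairs[of n], of real] assms by (simp add: of_nat_diff)
  have n2: "(real n)\<^sup>2 * 11 / 12 \<le> real n * (real n - 1)"
  proof -
    have "real n * 12 \<le> real n * real n" using assms by (intro mult_left_mono) auto
    then show ?thesis by (simp add: power2_eq_square algebra_simps)
  qed
  \<comment> \<open>Since K M \<le> K M^2, it is enough that (5/2) K M^2 is at most 3/2 times the
    number of pairs. The latter is at least (11/16) n^2 for n \<ge> 12, and (5/2) (67/288) is
    smaller than 11/16.\<close>
  have "z \<le> 3 / 2 * (N - x)"
    if "x \<le> z" "N = p / 2" "q * 11 / 12 \<le> p" "81 * z \<le> 603 / 32 * q" "0 \<le> q" for x z N p q :: real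
  proof -
    have "5 / 2 * z \<le> 11 / 16 * q" using that by simp
    moreover have "11 / 16 * q \<le> 3 / 4 * p" using that by simp
    moreover have "3 / 2 * (N - x) = 3 / 4 * p - 3 / 2 * x" unfolding that(2) by (simp add: field_simps)
    ultimately show ?thesis using that(1) by simp
  qed
  from this[OF KM2 pairs n2 KM zero_le_power2] show ?thesis by simp
qed

text \<open>Without rounding the right-hand side would be at least 2 L. Replacing n / (2 M) by its
  integer part costs at most 8 \<tau>^2 / 9 < 2/9, less than the spare L.\<close>

lemma many_disjoint_blocks:
  fixes \<tau> L :: real and n M :: nat
  assumes "0 < \<tau>" "\<tau> < 1 / 2" "2 / 3 \<le> L" "1 \<le> M"
    and M: "M \<le> 2 * real n * \<tau>\<^sup>2 / (9 * L)"
  shows "L \<le> 8 * real (n div (2 * M)) * \<tau>\<^sup>2 / 9" "0 < n div (2 * M)"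
proof -
  define r where "r = n div (2 * M)"
  have \<tau>2: "0 < \<tau>\<^sup>2" "\<tau>\<^sup>2 < 1 / 4"
    using assms power_strict_mono[of \<tau> "1 / 2" 2] by (auto simp: power_divide)
  have "n < 2 * M * (r + 1)"
    unfolding r_def using assms(4) dividend_less_times_div[of "2 * M" n] by simp
  then have "real n \<le> 2 * M * (r + 1)" by (metis less_imp_le of_nat_le_iff)
  then have "real n * \<tau>\<^sup>2 \<le> (2 * M * (r + 1)) * \<tau>\<^sup>2" using \<tau>2 by (intro mult_right_mono) auto
  moreover have "9 * L * M \<le> 2 * (real n * \<tau>\<^sup>2)" using M assms by (simp add: field_simps)
  ultimately have "M * (9 * L) \<le> M * (4 * (real r + 1) * \<tau>\<^sup>2)" by (simp add: algebra_simps)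
  then have *: "9 * L \<le> 4 * (real r + 1) * \<tau>\<^sup>2"
    using assms by (simp add: mult_le_cancel_left)
  then have "9 * L \<le> 4 * (r * \<tau>\<^sup>2) + 4 * \<tau>\<^sup>2" by (simp add: algebra_simps)
  then have **: "9 * L \<le> 8 * (r * \<tau>\<^sup>2)" using \<tau>2 assms(3) by simp
  then show "L \<le> 8 * real (n div (2 * M)) * \<tau>\<^sup>2 / 9" by (simp add: r_def)
  have "r \<noteq> 0" using ** assms(3) by (intro notI) simp
  then show "0 < n div (2 * M)" by (simp add: r_def)
qed

text \<open>The factor \<tau> / 3 cancels against the constants of the theorem, and the last term
  then matches the bound on v / M exactly. What remains to compare are the covariance terms.\<close>

lemma variance_bound:
  fixes v v1 \<tau> L N :: real
  assumes "0 \<le> v1" "v1 \<le> v" "0 < \<tau>" "3 \<le> N" and M: "1 / M \<le> 9 * L / (N * \<tau>\<^sup>2)"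
  shows "v / M + 4 * v1 / (N + 1)
    \<le> \<tau> / 3 * (12 * v1 / (N * \<tau>) + 6 * (v - 2 * v1) / (\<tau> * N * (N - 1)) + 27 * v * L / (N * \<tau> ^ 3))"
proof -
  have "v * (1 / M) \<le> v * (9 * L / (N * \<tau>\<^sup>2))" using assms by (intro mult_left_mono) auto
  moreover have "4 * v1 / (N + 1) \<le> 4 * v1 / N + 2 * (v - 2 * v1) / (N * (N - 1))"
  proof -
    have "4 * v1 / N - 4 * v1 / (N + 1) = 4 * v1 / (N * (N + 1))" using assms by (simp add: field_simps)
    \<comment> \<open>From \<open>v1 \<le> v\<close> the middle term may be as low as -2 v1 / (N (N
      - 1)). The gap between 4 v1 / N and 4 v1 / (N + 1) covers this as soon as N + 1 \<le> 2 (N -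
      1).\<close>
    moreover have "2 * v1 / (N * (N - 1)) \<le> 4 * v1 / (N * (N + 1))"
    proof -
      have "v1 * (N + 1) \<le> v1 * (2 * (N - 1))" using assms by (intro mult_left_mono) auto
      then have "v1 / (N - 1) \<le> 2 * v1 / (N + 1)" using assms by (simp add: field_simps)
      then have "2 / N * (v1 / (N - 1)) \<le> 2 / N * (2 * v1 / (N + 1))" using assms by (intro mult_left_mono) auto
      then show ?thesis by simp
    qed
    moreover have "- 2 * v1 / (N * (N - 1)) \<le> 2 * (v - 2 * v1) / (N * (N - 1))"
      using assms by (intro divide_right_mono) auto
    ultimately show ?thesis by simp
  qed
  moreover have "\<tau> / 3 * (12 * v1 / (N * \<tau>) + 6 * (v - 2 * v1) / (\<tau> * N * (N - 1)) + 27 * v * L / (N * \<tau> ^ 3))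
      = 4 * v1 / N + 2 * (v - 2 * v1) / (N * (N - 1)) + v * (9 * L / (N * \<tau>\<^sup>2))"
  proof -
    have "N - 1 \<noteq> 0" "N \<noteq> 0" "\<tau> \<noteq> 0" using assms by auto
    then have "\<tau> / 3 * (12 * v1 / (N * \<tau>)) = 4 * v1 / N"
      "\<tau> / 3 * (6 * (v - 2 * v1) / (\<tau> * N * (N - 1))) = 2 * (v - 2 * v1) / (N * (N - 1))"
      "\<tau> / 3 * (27 * v * L / (N * \<tau> ^ 3)) = v * (9 * L / (N * \<tau>\<^sup>2))"
      by (simp_all add: divide_simps power2_eq_square power3_eq_cube)
    then show ?thesis by (simp only: distrib_left)
  qed
  moreover have "v * (1 / M) = v / M" by simp
  ultimately show ?thesis by linarith
qed

subsection \<open>The deviation bound\<close>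

theorem theorem3p3:
  fixes P :: "'w measure" and Z :: "'z measure"
    and X :: "nat \<Rightarrow> 'w \<Rightarrow> 'z" and J :: "nat \<Rightarrow> nat \<Rightarrow> 'w \<Rightarrow> nat \<times> nat"
    and h :: "'z \<Rightarrow> 'z \<Rightarrow> real"
    and \<delta> \<tau> :: real and n K M :: nat
  assumes "0 < \<delta>" and "\<delta> < 1"
    and "0 < \<tau>" and "\<tau> < 1/2"
    and "g \<tau> \<delta> \<le> 1/4"
    and "0 < n" and "real n \<ge> 9 * ln (2 / \<delta>) / (2 * \<tau>\<^sup>2)"
    and "K = nat \<lceil>8 / (1/2 - \<tau>)\<^sup>2 * ln (2 / \<delta>)\<rceil>"
    and "M = nat \<lfloor>2 * real n * \<tau>\<^sup>2 / (9 * ln (2 / \<delta>))\<rfloor>"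
    and "prob_space P"
    and "iid_sample P Z n X"
    and "uniform_draws P n K M J"
    and "draws_indep_of_sample P Z n K M X J"
    and "(\<lambda>(x, y). h x y) \<in> borel_measurable (Z \<Otimes>\<^sub>M Z)"
    and "\<forall>x\<in>space Z. \<forall>y\<in>space Z. h x y = h y x"
    and "integrable P (\<lambda>\<omega>. (h (X 1 \<omega>) (X 2 \<omega>))\<^sup>2)"
  shows "measure P {\<omega> \<in> space P. \<bar>MoIU K M X J h \<omega> - theta P X h\<bar>
           \<le> sqrt (12 * sigma1_sq P Z X h / (real n * \<tau>)
                   + 6 * sigma2_sq P Z X h / (\<tau> * real n * (real n - 1))
                   + 27 * sigma_sq P X h * ln (2 / \<delta>) / (real n * \<tau> ^ 3))}
         \<ge> 1 - \<delta>"
proof -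
  define L where "L = ln (2 / \<delta>)"
  define s where "s = 1 / 2 - \<tau>"
  have s: "0 < s" using assms(4) by (simp add: s_def)
  have L23: "2 / 3 \<le> L"
  proof -
    have "ln 2 \<le> ln (2 / \<delta>)" using assms(1,2) by (subst ln_le_cancel_iff) (auto simp: field_simps)
    then show ?thesis using ln2_ge_two_thirds by (simp add: L_def)
  qed
  have expL: "exp (- L) = \<delta> / 2" using assms(1) by (simp add: L_def exp_minus)
  have gL: "4 * \<tau> ^ 4 / (9 * s\<^sup>2 * L) \<le> 1 / 4"
    using assms(5) by (simp add: g_def s_def L_def)
  note bounds = block_size_bounds[OF assms(3,4) L23 assms(7)[folded L_def]
      assms(8)[folded L_def] assms(9)[folded L_def]]
  have n12: "12 \<le> n" and M1: "1 \<le> M" and K1: "1 \<le> K" by (fact bounds)+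
  define r where "r = n div (2 * M)"
  have r: "L \<le> 8 * real r * \<tau>\<^sup>2 / 9" "0 < r"
    unfolding r_def using many_disjoint_blocks[OF assms(3,4) L23 M1 bounds(3)] by auto
  have rM: "2 * M * r \<le> n" unfolding r_def by (rule times_div_less_eq_dividend)
  have KM: "K * M\<^sup>2 \<le> 3 / 2 * (card (index_pairs n) - real K * M)"
    by (rule few_draws[OF s _ n12 M1 bounds(3) bounds(7)[folded s_def] gL]) (use L23 in simp)

  interpret P: prob_space P by fact
  define \<mu> where "\<mu> = distr P Z (X 1)"
  define I where "I = {1..n}"
  have I12: "1 \<in> I" "2 \<in> I" using n12 by (auto simp: I_def)
  have ind: "P.indep_vars (\<lambda>_. Z) X I" and law: "\<And>i. i \<in> I \<Longrightarrow> distr P Z (X i) = \<mu>"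
    using assms(11) unfolding iid_sample_def \<mu>_def I_def by blast+
  have X [measurable]: "X i \<in> measurable P Z" if "i \<in> I" for i
    using ind that by (auto simp: P.indep_vars_def)
  note X1 = X[OF I12(1)] and X2 = X[OF I12(2)]
  have sets\<mu> [measurable_cong, simp]: "sets \<mu> = sets Z" and space\<mu> [simp]: "space \<mu> = space Z"
    by (simp_all add: \<mu>_def)
  have pair: "(\<lambda>\<omega>. (X 1 \<omega>, X 2 \<omega>)) \<in> measurable P (\<mu> \<Otimes>\<^sub>M \<mu>)"
    using X1 X2 by measurable
  have pair_law: "distr P (\<mu> \<Otimes>\<^sub>M \<mu>) (\<lambda>\<omega>. (X 1 \<omega>, X 2 \<omega>)) = \<mu> \<Otimes>\<^sub>M \<mu>"
  proof -
    have "P.indep_var (PiM {1} (\<lambda>_. Z)) (\<lambda>\<omega>. restrict (\<lambda>i. X i \<omega>) {1}) (PiM {2} (\<lambda>_. Z)) (\<lambda>\<omega>. restrict (\<lambda>i. X i \<omega>) {2})"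
      using I12 by (intro P.indep_var_restrict[OF ind]) auto
    from P.indep_var_compose[OF this measurable_component_singleton[of 1] measurable_component_singleton[of 2]]
    have "P.indep_var Z (X 1) Z (X 2)" by (simp add: comp_def)
    then have "distr P Z (X 1) \<Otimes>\<^sub>M distr P Z (X 2) = distr P (Z \<Otimes>\<^sub>M Z) (\<lambda>\<omega>. (X 1 \<omega>, X 2 \<omega>))"
      by (simp add: P.indep_var_distribution_eq)
    moreover have "distr P (\<mu> \<Otimes>\<^sub>M \<mu>) (\<lambda>\<omega>. (X 1 \<omega>, X 2 \<omega>)) = distr P (Z \<Otimes>\<^sub>M Z) (\<lambda>\<omega>. (X 1 \<omega>, X 2 \<omega>))"
      by (intro distr_cong sets_pair_measure_cong) auto
    ultimately show ?thesis using law I12 by simp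
  qed
  \<comment> \<open>The common law of the observations becomes the base measure; square
    integrability of the kernel is carried over from \<open>P\<close> by
    \<open>pair_law\<close>.\<close>
  interpret kernel_sample \<mu> n h
  proof (intro kernel_sample.intro kernel_sample_axioms.intro)
    show "prob_space \<mu>" unfolding \<mu>_def using X1 by (rule P.prob_space_distr)
    show hb: "(\<lambda>(x, y). h x y) \<in> borel_measurable (\<mu> \<Otimes>\<^sub>M \<mu>)"
      using assms(14) by (simp add: measurable_cong_sets[OF sets_pair_measure_cong[OF sets\<mu> sets\<mu>] refl])
    have "(\<lambda>(x, y). (h x y)\<^sup>2) \<in> borel_measurable (\<mu> \<Otimes>\<^sub>M \<mu>)"
      using borel_measurable_power[OF hb, of 2] by (simp add: case_prod_unfold)
    from integrable_distr_eq[OF pair this] show "integrable (\<mu> \<Otimes>\<^sub>M \<mu>) (\<lambda>(x, y). (h x y)\<^sup>2)"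
      using assms(16) unfolding pair_law by simp
    show "3 \<le> n" using n12 by simp
  qed (use assms(15) in auto)

  have mean_eq: "theta P X h = mean"
    using integral_distr[OF pair, of "\<lambda>p. h (fst p) (snd p)"]
    unfolding pair_law by (simp add: theta_def mean_def case_prod_unfold)
  have var_eq: "sigma_sq P X h = var"
    using integral_distr[OF pair, of "\<lambda>p. (h0 (fst p) (snd p))\<^sup>2"] mean_eq
    unfolding pair_law by (simp add: sigma_sq_def var_def case_prod_unfold theta_def h0_def)
  have var1_eq: "sigma1_sq P Z X h = var1"
    unfolding sigma1_sq_def
  proof (rule variance_cond_exp)
    show "X 1 \<in> measurable P \<mu>" "X 2 \<in> measurable P \<mu>" using X1 X2 by (simp_all add: measurable_cong_sets[OF refl sets\<mu>])
    show "distr P \<mu> (X 1) = \<mu>" using distr_cong[of P P \<mu> Z "X 1" "X 1"] law[OF I12(1)] by simp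
  qed (use pair_law assms(10) in simp_all)

  define E where "E = 12 * var1 / (real n * \<tau>) + 6 * (var - 2 * var1) / (\<tau> * real n * (real n - 1))
    + 27 * var * L / (real n * \<tau> ^ 3)"
  have vE: "var / M + 4 * var1 / (real n + 1) \<le> \<tau> / 3 * E"
    unfolding E_def using var1_nonneg var1_le_var assms(3) n12 bounds(4) by (intro variance_bound) auto
  \<comment> \<open>\<open>E\<close> contains var - 2 var1, whose sign is not established here;
    nonnegativity of \<open>E\<close> is read off from \<open>vE\<close> so that the square root can
    be squared.\<close>
  have "0 \<le> var / M + 4 * var1 / (real n + 1)" using var1_nonneg var1_le_var by simp
  with vE have "0 \<le> \<tau> / 3 * E" by linarith
  then have E0: "0 \<le> E" using assms(3) by (simp add: zero_le_mult_iff)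
  define t where "t = sqrt E"
  have t: "0 \<le> t" "t\<^sup>2 = E" using E0 by (simp_all add: t_def)

  define F where "F = draw_families n K M"
  have F_eq: "F = inj_maps ({1..K} \<times> {1..M}) (index_pairs n)"
    by (simp add: F_def draw_families_def inj_maps_def)
  have fF: "finite F" by (simp add: F_eq)
  define joint where "joint = joint_draw K M J"
  have joint [measurable]: "joint \<in> measurable P (count_space F)"
    and joint_law: "distr P (count_space F) joint = uniform_count_measure F"
    using assms(12) by (auto simp: uniform_draws_def joint_def F_def)
  \<comment> \<open>The draw attains a value in \<open>F\<close> at some point of the nonempty space
    \<open>P\<close>.\<close>
  have F_pos: "0 < card F"
  proof -
    obtain \<omega> where "\<omega> \<in> space P" using P.not_empty by auto
    then have "joint \<omega> \<in> F" using measurable_space[OF joint] by simp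
    then show ?thesis using fF by (auto simp: card_gt_0_iff)
  qed
  have prob_joint: "P.prob (joint -` {f} \<inter> space P) = 1 / card F" if "f \<in> F" for f
    using measure_distr[OF joint, of "{f}"] that fF
    by (simp add: joint_law measure_uniform_count_measure)

  define Xr where "Xr \<omega> = (\<lambda>i\<in>{1..n}. X i \<omega>)" for \<omega>
  have setsD: "sets D = sets (PiM {1..n} (\<lambda>_. Z))"
    unfolding D_def by (intro sets_PiM_cong) simp_all
  have Xr_Z: "Xr \<in> measurable P (PiM {1..n} (\<lambda>_. Z))"
    unfolding Xr_def using X by (intro measurable_restrict) (simp add: I_def)
  then have Xr: "Xr \<in> measurable P D"
    by (simp add: measurable_cong_sets[OF refl setsD])
  have Xr_law: "distr P D Xr = D"
  proof -
    have "distr P (PiM I (\<lambda>_. Z)) (\<lambda>\<omega>. \<lambda>i\<in>I. X i \<omega>) = PiM I (\<lambda>i. distr P Z (X i))"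
      using P.indep_vars_iff_distr_eq_PiM'[of I X "\<lambda>_. Z"] X ind I12 by auto
    also have "\<dots> = D"
      unfolding D_def I_def using law by (intro PiM_cong) (auto simp: I_def)
    also have "distr P (PiM I (\<lambda>_. Z)) (\<lambda>\<omega>. \<lambda>i\<in>I. X i \<omega>) = distr P D Xr"
      using setsD by (intro distr_cong) (auto simp: Xr_def I_def)
    finally show ?thesis .
  qed
  define A where "A f = {x \<in> space D. \<bar>med K M f x - mean\<bar> \<le> t}" for f
  have A: "A f \<in> sets D" and A_prob: "D.prob (A f) = 1 - D.prob {x \<in> space D. t < \<bar>med K M f x - mean\<bar>}"
    if "f \<in> F" for f
  proof -
    have [measurable]: "med K M f \<in> borel_measurable D"
      using that K1 by (intro med_borel) (auto simp: F_eq)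
    show "A f \<in> sets D" unfolding A_def by measurable
    have "{x \<in> space D. t < \<bar>med K M f x - mean\<bar>} \<in> sets D" by measurable
    moreover have "A f = space D - {x \<in> space D. t < \<bar>med K M f x - mean\<bar>}" by (auto simp: A_def)
    ultimately show "D.prob (A f) = 1 - D.prob {x \<in> space D. t < \<bar>med K M f x - mean\<bar>}"
      by (simp add: D.prob_compl)
  qed
  \<comment> \<open>Splits the good event by the realised draw: on \<open>G f\<close> the estimator
    is the fixed function \<open>med K M f\<close> of the sample, and independence factors the
    probability.\<close>
  define G where "G f = (Xr -` A f \<inter> space P) \<inter> (joint -` {f} \<inter> space P)" for f
  have G_sets: "G f \<in> P.events" if "f \<in> F" for f
    unfolding G_def using measurable_sets[OF Xr A[OF that]] measurable_sets[OF joint, of "{f}"] that by auto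
  have G_prob: "P.prob (G f) = D.prob (A f) / card F" if f: "f \<in> F" for f
  proof -
    have "P.prob (G f) = P.prob (Xr -` A f \<inter> space P) * P.prob (joint -` {f} \<inter> space P)"
      unfolding G_def
    proof (rule P.indep_setD)
      show "P.indep_set (sets (vimage_algebra (space P) Xr (PiM {1..n} (\<lambda>_. Z))))
          (sets (vimage_algebra (space P) joint (count_space F)))"
        using assms(13) by (simp add: draws_indep_of_sample_def Xr_def[abs_def] joint_def F_def)
      show "Xr -` A f \<inter> space P \<in> sets (vimage_algebra (space P) Xr (PiM {1..n} (\<lambda>_. Z)))"
        using A[OF f] setsD by (intro in_vimage_algebra) simp
      show "joint -` {f} \<inter> space P \<in> sets (vimage_algebra (space P) joint (count_space F))"
        using f by (intro in_vimage_algebra) simp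
    qed
    also have "P.prob (Xr -` A f \<inter> space P) = D.prob (A f)"
      using measure_distr[OF Xr A[OF f]] Xr_law by simp
    finally show ?thesis using prob_joint[OF f] by simp
  qed
  have MoIU_eq: "MoIU K M X J h \<omega> = med K M (joint \<omega>) (Xr \<omega>)" if "\<omega> \<in> space P" for \<omega>
  proof -
    have jF: "joint \<omega> \<in> F" using measurable_space[OF joint that] by simp
    have "block_U M X J h k \<omega> = pair_mean M h (block {1..M} k (joint \<omega>)) (Xr \<omega>)" if k: "k \<in> {1..K}" for k
    proof -
      have "h (X (fst (J k m \<omega>)) \<omega>) (X (snd (J k m \<omega>)) \<omega>)
          = h (Xr \<omega> (fst (block {1..M} k (joint \<omega>) m))) (Xr \<omega> (snd (block {1..M} k (joint \<omega>) m)))"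
        if m: "m \<in> {1..M}" for m
      proof -
        have eq: "block {1..M} k (joint \<omega>) m = J k m \<omega>"
          using k m by (simp add: block_def joint_def joint_draw_def)
        have "block {1..M} k (joint \<omega>) \<in> inj_maps {1..M} (index_pairs n)"
          using jF k by (intro block_in_inj_maps) (auto simp: F_eq)
        from inj_maps_index(1,2)[OF this m] show ?thesis unfolding eq by (simp add: Xr_def)
      qed
      then have "(\<Sum>m=1..M. h (X (fst (J k m \<omega>)) \<omega>) (X (snd (J k m \<omega>)) \<omega>))
          = (\<Sum>m=1..M. h (Xr \<omega> (fst (block {1..M} k (joint \<omega>) m))) (Xr \<omega> (snd (block {1..M} k (joint \<omega>) m))))"
        by (rule sum.cong[OF refl])
      then show ?thesis by (simp add: block_U_def pair_mean_def)
    qed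
    then have "map (\<lambda>k. block_U M X J h k \<omega>) [1..<K + 1]
        = map (\<lambda>k. pair_mean M h (block {1..M} k (joint \<omega>)) (Xr \<omega>)) [1..<K + 1]"
      by (intro map_cong) auto
    then show ?thesis unfolding MoIU_def med_def by (rule arg_cong)
  qed
  have good: "{\<omega> \<in> space P. \<bar>MoIU K M X J h \<omega> - mean\<bar> \<le> t} = (\<Union>f\<in>F. G f)"
    using measurable_space[OF joint] measurable_space[OF Xr]
    by (auto simp: G_def A_def MoIU_eq)
  have "P.prob (\<Union>f\<in>F. G f) = (\<Sum>f\<in>F. P.prob (G f))"
    using fF G_sets by (intro P.finite_measure_finite_Union) (auto simp: disjoint_family_on_def G_def)
  also have "\<dots> = (\<Sum>f\<in>F. 1 - D.prob {x \<in> space D. t < \<bar>med K M f x - mean\<bar>}) / card F"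
    unfolding sum_divide_distrib by (intro sum.cong) (simp_all add: G_prob A_prob)
  also have "\<dots> = 1 - (\<Sum>f\<in>F. D.prob {x \<in> space D. t < \<bar>med K M f x - mean\<bar>}) / card F"
    using F_pos by (simp add: sum_subtractf diff_divide_distrib)
  also have "\<dots> \<ge> 1 - \<delta>"
  proof -
    have "(\<Sum>f\<in>F. D.prob {x \<in> space D. t < \<bar>med K M f x - mean\<bar>})
        \<le> card F * (exp (- 8 * real r * \<tau>\<^sup>2 / 9) + exp (- real K * s\<^sup>2 / 8))"
      unfolding F_eq s_def using M1 K1 assms(3,4) t r rM KM vE
      by (intro sum_prob_med_far_le) auto
    \<comment> \<open>Both exponents are at most -L, by the choices of \<open>M\<close> and
      \<open>K\<close>, and each exponential contributes \<delta>/2.\<close>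
    also have "\<dots> \<le> card F * (exp (- L) + exp (- L))"
      using r bounds(6) by (intro mult_left_mono add_mono) (auto simp: s_def)
    also have "\<dots> = card F * \<delta>" by (simp add: expL)
    finally show ?thesis using F_pos by (simp add: divide_le_eq mult.commute)
  qed
  finally have "1 - \<delta> \<le> P.prob {\<omega> \<in> space P. \<bar>MoIU K M X J h \<omega> - mean\<bar> \<le> t}"
    by (simp add: good)
  then show ?thesis
    by (simp only: mean_eq var_eq var1_eq sigma2_sq_def t_def E_def L_def)
qed

end
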